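(* Let $\mathfrak g$ be a finite-dimensional complex Frobenius Lie algebra and let $F\in\mathfrak g^*$ be a Frobenius functional whose principal element $H$ is semisimple with integral eigenvalues. Let $\mathfrak g=\bigoplus_{j\in\mathbb Z}\mathfrak g_j$ be the principal grading and $h_j=\dim\mathfrak g_j$. Then the centered cocharacter $\lambda_H:\mathbb C^\times\to GL(\mathfrak g)$ given by $$\lambda_H(x)|_{\mathfrak g_j}=x^{2j-1}\operatorname{id}_{\mathfrak g_j}$$ preserves the Kirillov form $B_F$, and $$\Theta_{\mathfrak g}(x)=\sum_{m\ge1}(h_m-h_{m+1})\,\chi_{2m-1}(x).\qquad( * )$$ The following are equivalent: (1) the principal multiplicities are unimodal; (2) the virtual $SL_2$ character $\Theta_{\mathfrak g}$ is effective, i.e. every coefficient $h_m-h_{m+1}$ in $( * )$ is nonnegative; (3) $\lambda_H$ extends to a homomorphism $SL_2\to Sp(\mathfrak g,B_F)$, i.e. there is a homomorphism of algebraic groups $SL_2\to Sp(\mathfrak g,B_F)$ whose restriction to the diagonal torus $\{\operatorname{diag}(x,x^{-1})\}$ is $\lambda_H(x)$. Moreover, strict unimodality of the principal multiplicities is equivalent to strict positivity of every coefficient in $( * )$ through the occupied positive support, i.e. to $h_m-h_{m+1}>0$ for all $1\le m\le N$, where $N$ is the largest integer with $h_N\ne0$.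
   Context: A finite-dimensional complex Lie algebra $\mathfrak g$ is Frobenius if there is $F\in\mathfrak g^*$ (a Frobenius functional) whose Kirillov form $B_F(x,y)=F([x,y])$ is nondegenerate. The principal element $H=\widehat F\in\mathfrak g$ is the unique element with $F([H,x])=F(x)$ for all $x\in\mathfrak g$. "Semisimple with integral eigenvalues" refers to $\operatorname{ad}H$ acting on $\mathfrak g$; then $\mathfrak g_j=\{x\in\mathfrak g:[H,x]=jx\}$, and $h_j=\dim\mathfrak g_j$ are the principal multiplicities. The form $B_F$ is symplectic, $Sp(\mathfrak g,B_F)$ is its symplectic group, and $B_F$ pairs $\mathfrak g_j$ perfectly with $\mathfrak g_{1-j}$, so $h_{1-j}=h_j$. The multiplicities are unimodal if $h_1\ge h_2\ge h_3\ge\cdots$, and strictly unimodal if $h_1>h_2>\cdots>h_N>0$ with $N$ the largest integer such that $h_N\ne0$ (the central equality $h_0=h_1$ is allowed). The centered principal character is $\Theta_{\mathfrak g}(x)=\sum_j h_j x^{2j-1}$, and $\chi_n(x)=x^n+x^{n-2}+\cdots+x^{-n}$ is the character of the irreducible $SL_2$-representation $\operatorname{Sym}^n(\mathbb C^2)$. *)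

theory Defs
  imports "HOL-Analysis.Determinants" "HOL-Algebra.Group"
begin

locale complex_lie_algebra = vector_space smul
  for smul :: "complex \<Rightarrow> 'g::ab_group_add \<Rightarrow> 'g" +
  fixes br :: "'g \<Rightarrow> 'g \<Rightarrow> 'g"
  assumes finite_dim: "\<exists>B. finite B \<and> span B = UNIV"
    and br_linear_left: "Vector_Spaces.linear smul smul (\<lambda>x. br x y)"
    and br_linear_right: "Vector_Spaces.linear smul smul (br x)"
    and br_alternating: "br x x = 0"
    and jacobi: "br x (br y z) + br y (br z x) + br z (br x y) = 0"

definition kirillov_form :: "('g \<Rightarrow> 'g \<Rightarrow> 'g) \<Rightarrow> ('g \<Rightarrow> complex) \<Rightarrow> 'g \<Rightarrow> 'g \<Rightarrow> complex" where
  "kirillov_form br F x y = F (br x y)"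

text \<open>The form is alternating, so nondegeneracy in the first argument suffices.\<close>
definition frobenius_functional ::
  "(complex \<Rightarrow> 'g::ab_group_add \<Rightarrow> 'g) \<Rightarrow> ('g \<Rightarrow> 'g \<Rightarrow> 'g) \<Rightarrow> ('g \<Rightarrow> complex) \<Rightarrow> bool" where
  "frobenius_functional smul br F \<longleftrightarrow>
     Vector_Spaces.linear smul (*) F \<and>
     (\<forall>x. (\<forall>y. kirillov_form br F x y = 0) \<longrightarrow> x = 0)"

definition principal_element :: "('g \<Rightarrow> 'g \<Rightarrow> 'g) \<Rightarrow> ('g \<Rightarrow> complex) \<Rightarrow> 'g" where
  "principal_element br F = (THE H. \<forall>x. F (br H x) = F x)"

definition semisimple_endomorphism ::
  "(complex \<Rightarrow> 'g::ab_group_add \<Rightarrow> 'g) \<Rightarrow> ('g \<Rightarrow> 'g) \<Rightarrow> bool" where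
  "semisimple_endomorphism smul T \<longleftrightarrow>
     Vector_Spaces.linear smul smul T \<and>
     (\<forall>W. module.subspace smul W \<and> T ` W \<subseteq> W \<longrightarrow>
       (\<exists>W'. module.subspace smul W' \<and> T ` W' \<subseteq> W' \<and>
             W \<inter> W' = {0} \<and> (\<forall>v. \<exists>w\<in>W. \<exists>w'\<in>W'. v = w + w')))"

definition integral_eigenvalues ::
  "(complex \<Rightarrow> 'g::ab_group_add \<Rightarrow> 'g) \<Rightarrow> ('g \<Rightarrow> 'g) \<Rightarrow> bool" where
  "integral_eigenvalues smul T \<longleftrightarrow> (\<forall>c v. v \<noteq> 0 \<and> T v = smul c v \<longrightarrow> c \<in> \<int>)"

definition principal_part ::
  "(complex \<Rightarrow> 'g::ab_group_add \<Rightarrow> 'g) \<Rightarrow> ('g \<Rightarrow> 'g \<Rightarrow> 'g) \<Rightarrow> ('g \<Rightarrow> complex) \<Rightarrow> int \<Rightarrow> 'g set" where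
  "principal_part smul br F j = {x. br (principal_element br F) x = smul (of_int j) x}"

definition principal_mult ::
  "(complex \<Rightarrow> 'g::ab_group_add \<Rightarrow> 'g) \<Rightarrow> ('g \<Rightarrow> 'g \<Rightarrow> 'g) \<Rightarrow> ('g \<Rightarrow> complex) \<Rightarrow> int \<Rightarrow> nat" where
  "principal_mult smul br F j = vector_space.dim smul (principal_part smul br F j)"

definition unimodal :: "(int \<Rightarrow> nat) \<Rightarrow> bool" where
  "unimodal h \<longleftrightarrow> (\<forall>m\<ge>1. h (m + 1) \<le> h m)"

definition largest_support :: "(int \<Rightarrow> nat) \<Rightarrow> int \<Rightarrow> bool" where
  "largest_support h N \<longleftrightarrow> h N \<noteq> 0 \<and> (\<forall>j>N. h j = 0)"

definition strictly_unimodal :: "(int \<Rightarrow> nat) \<Rightarrow> int \<Rightarrow> bool" where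
  "strictly_unimodal h N \<longleftrightarrow> (\<forall>m. 1 \<le> m \<and> m < N \<longrightarrow> h m > h (m + 1)) \<and> h N > 0"

text \<open>
  Laurent polynomials are represented by the functions they define on the nonzero complex
  numbers.  All multiplicity functions to which the next definitions are applied have
  finite support, so that the sums below are finite.
\<close>
definition centered_character :: "(int \<Rightarrow> nat) \<Rightarrow> complex \<Rightarrow> complex" where
  "centered_character h x = (\<Sum>j | h j \<noteq> 0. of_nat (h j) * x powi (2 * j - 1))"

definition sl2_char :: "nat \<Rightarrow> complex \<Rightarrow> complex" where
  "sl2_char n x = (\<Sum>k=0..n. x powi (int n - 2 * int k))"

definition sl2_coeff :: "(int \<Rightarrow> nat) \<Rightarrow> int \<Rightarrow> int" where
  "sl2_coeff h m = int (h m) - int (h (m + 1))"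

definition mult_group :: "complex monoid" where
  "mult_group = \<lparr>carrier = UNIV - {0}, mult = (*), one = 1\<rparr>"

definition SL2 :: "(complex^2^2) monoid" where
  "SL2 = \<lparr>carrier = {A. det A = 1}, mult = (**), one = mat 1\<rparr>"

definition symplectic_group ::
  "(complex \<Rightarrow> 'g::ab_group_add \<Rightarrow> 'g) \<Rightarrow> ('g \<Rightarrow> 'g \<Rightarrow> complex) \<Rightarrow> ('g \<Rightarrow> 'g) monoid" where
  "symplectic_group smul B =
     \<lparr>carrier = {L. Vector_Spaces.linear smul smul L \<and> bij L \<and> (\<forall>u v. B (L u) (L v) = B u v)},
      mult = (\<circ>), one = id\<rparr>"

text \<open>
  The linear map below is unique because the spaces \<open>principal_part smul br F j\<close> span the
  whole space when the adjoint action of the principal element is semisimple with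
  integral eigenvalues.
\<close>
definition centered_cocharacter ::
  "(complex \<Rightarrow> 'g::ab_group_add \<Rightarrow> 'g) \<Rightarrow> ('g \<Rightarrow> 'g \<Rightarrow> 'g) \<Rightarrow> ('g \<Rightarrow> complex) \<Rightarrow> complex \<Rightarrow> 'g \<Rightarrow> 'g" where
  "centered_cocharacter smul br F x =
     (THE L. Vector_Spaces.linear smul smul L \<and>
        (\<forall>j. \<forall>v\<in>principal_part smul br F j. L v = smul (x powi (2 * j - 1)) v))"

inductive matrix_polynomial :: "(complex^2^2 \<Rightarrow> complex) \<Rightarrow> bool" where
  "matrix_polynomial (\<lambda>A. c)"
| "matrix_polynomial (\<lambda>A. A $ i $ j)"
| "matrix_polynomial p \<Longrightarrow> matrix_polynomial q \<Longrightarrow> matrix_polynomial (\<lambda>A. p A + q A)"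
| "matrix_polynomial p \<Longrightarrow> matrix_polynomial q \<Longrightarrow> matrix_polynomial (\<lambda>A. p A * q A)"

text \<open>
  A homomorphism of algebraic groups is a group homomorphism that is a morphism of varieties.
  Regular functions on \<open>SL2\<close> are restrictions of polynomials in the matrix entries, and
  it is enough to require that matrix coefficients be regular: the inverse of
  the determinant of \<open>\<rho> A\<close> is the determinant of \<open>\<rho>\<close> at the inverse of \<open>A\<close>.
\<close>
definition algebraic_SL2_hom ::
  "(complex \<Rightarrow> 'g::ab_group_add \<Rightarrow> 'g) \<Rightarrow> ('g \<Rightarrow> 'g \<Rightarrow> complex) \<Rightarrow> (complex^2^2 \<Rightarrow> 'g \<Rightarrow> 'g) \<Rightarrow> bool" where
  "algebraic_SL2_hom smul B \<rho> \<longleftrightarrow>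
     \<rho> \<in> hom SL2 (symplectic_group smul B) \<and>
     (\<forall>f v. Vector_Spaces.linear smul (*) f \<longrightarrow>
        (\<exists>p. matrix_polynomial p \<and> (\<forall>A\<in>carrier SL2. f (\<rho> A v) = p A)))"

definition diag_torus :: "complex \<Rightarrow> complex^2^2" where
  "diag_torus x = vector [vector [x, 0], vector [0, inverse x]]"

end

theory Submission
  imports Defs "HOL-Computational_Algebra.Fundamental_Theorem_Algebra"
begin

text \<open>
  The Jacobi identity makes the bracket additive on eigenvalues of \<open>ad H\<close>, and \<open>F([H,x]) = F(x)\<close>;
  hence the Kirillov form pairs the part of degree \<open>j\<close> only with the part of degree \<open>1 - j\<close>.
  Once \<open>ad H\<close> is diagonalised (\<open>semisimple_integral_eigenbasis\<close>), everything therefore takes place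
  in a finite-dimensional graded symplectic space with this pairing rule.  There the cocharacter is
  symplectic because the weights \<open>2j - 1\<close> and \<open>2(1 - j) - 1\<close> cancel, the multiplicities satisfy
  \<open>h(1 - j) = h(j)\<close>, and the decomposition of the character is summation by parts, since
  \<open>\<chi>\<^sub>2\<^sub>m\<^sub>-\<^sub>1\<close> and \<open>\<chi>\<^sub>2\<^sub>m\<^sub>-\<^sub>3\<close> differ by the two outermost powers of \<open>x\<close>.

  Suppose that the cocharacter extends to an algebraic homomorphism \<open>\<rho>\<close> on \<open>SL\<^sub>2\<close>.  Instead of
  differentiating \<open>\<rho>\<close> to a representation of the Lie algebra, the raising and lowering operators are
  read off as the components of degree \<open>+1\<close> and \<open>-1\<close> of \<open>\<rho>\<close> at the two elementary unipotent
  matrices.  Conjugation by the torus determines the components of \<open>\<rho>(u(z))\<close> for all \<open>z\<close> from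
  those at \<open>z = 1\<close> (\<open>unipotent_coordinates\<close>), and the matrix identity \<open>unipotent_exchange\<close>,
  differentiated at a single point, gives \<open>ef - fe = 2j - 1\<close> in degree \<open>j\<close>
  (\<open>commutation_relation\<close>).  The usual infinite-ladder argument then shows that \<open>f\<close> is injective
  in positive degrees (\<open>lowering_injective\<close>), and comparing dimensions gives unimodality.

  Conversely, let the multiplicities be unimodal.  Choose bases of the parts of positive degree,
  numbered so that the \<open>i\<close>-th basis vectors of the degrees \<open>1, 2, \<dots>\<close> form an uninterrupted string,
  and complete each string by the dual basis vectors (\<open>exists_string_decomposition\<close>).  Scaled by
  signed binomial coefficients, a string of length \<open>n + 1\<close> spans a copy of \<open>Sym\<^sup>n(\<complex>\<^sup>2)\<close>.  The action
  of \<open>SL\<^sub>2\<close> is the linear one that moves the points \<open>\<nu>(p)\<close> of its rational normal curve by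
  \<open>\<nu>(p) \<mapsto> \<nu>(A p)\<close>.  These points span, and the form evaluates on them to \<open>det(p,q)\<^sup>n\<close>
  (\<open>om_veronese\<close>), so multiplicativity, invariance of the form and the value on the torus can all be
  checked on the curve, where they are immediate.
\<close>

section \<open>Eigenbases of semisimple endomorphisms\<close>

locale complex_space = finite_dimensional_vector_space scale Basis
  for scale :: "complex \<Rightarrow> 'g::ab_group_add \<Rightarrow> 'g" (infixr "\<odot>" 75) and Basis :: "'g set"
begin

abbreviation crd :: "'g \<Rightarrow> 'g \<Rightarrow> complex" where
  "crd \<equiv> representation Basis"

lemma vector_space_scale: "vector_space scale" by unfold_locales

lemma linear_endoI:
  assumes "\<And>v w. L (v + w) = L v + L w" "\<And>c v. L (c \<odot> v) = c \<odot> L v"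
  shows "Vector_Spaces.linear scale scale L"
  using assms vector_space_scale by (simp add: Vector_Spaces.linear_iff)

lemma linear_zero: "Vector_Spaces.linear scale scale L \<Longrightarrow> L 0 = 0"
  using Vector_Spaces.linear.axioms(3) module_hom.zero by metis

lemma linear_functionalI:
  assumes "\<And>v w. f (v + w) = f v + f w" "\<And>c v. f (c \<odot> v) = c * f v"
  shows "Vector_Spaces.linear scale (*) f"
  using assms vector_space_scale vector_space_over_itself.vector_space_axioms
  by (simp add: Vector_Spaces.linear_iff)

lemma crd_add [simp]: "crd (v + w) b = crd v b + crd w b"
  by (simp add: representation_add independent_Basis span_Basis)

lemma crd_scale [simp]: "crd (c \<odot> v) b = c * crd v b"
  by (simp add: representation_scale independent_Basis span_Basis)

lemma linear_crd: "Vector_Spaces.linear scale (*) (\<lambda>v. crd v b)"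
  by (rule linear_functionalI) auto

lemma crd_zero [simp]: "crd 0 b = 0"
  by (simp add: representation_zero)

lemma crd_sum: "crd (sum f S) b = (\<Sum>s\<in>S. crd (f s) b)"
  by (induction S rule: infinite_finite_induct) auto

lemma crd_Basis: "b \<in> Basis \<Longrightarrow> crd b c = (if c = b then 1 else 0)"
  by (simp add: representation_basis independent_Basis)

lemma crd_expansion: "(\<Sum>b\<in>Basis. crd v b \<odot> b) = v"
  by (rule sum_representation_eq) (auto simp: independent_Basis span_Basis finite_Basis)

lemma crd_sum_Basis:
  assumes "b \<in> Basis" "S \<subseteq> Basis"
  shows "crd (\<Sum>c\<in>S. a c \<odot> c) b = (if b \<in> S then a b else 0)"
proof -
  have S: "finite S" using assms(2) finite_Basis by (rule finite_subset)
  have "crd (\<Sum>c\<in>S. a c \<odot> c) b = (\<Sum>c\<in>S. if b = c then a c else 0)"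
    unfolding crd_sum by (rule sum.cong) (use assms in \<open>auto simp: crd_Basis\<close>)
  then show ?thesis using S by simp
qed

lemma crd_eqI: "(\<And>b. b \<in> Basis \<Longrightarrow> crd v b = crd w b) \<Longrightarrow> v = w"
  by (metis (no_types, lifting) crd_expansion sum.cong)

lemma exists_linear_relation:
  fixes f :: "nat \<Rightarrow> 'g"
  shows "\<exists>n u. (\<exists>i\<le>n. u i \<noteq> 0) \<and> (\<Sum>i\<le>n. u i \<odot> f i) = 0"
proof -
  define n where "n = card Basis"
  show ?thesis
  proof (cases "inj_on f {..n}")
    case True
    then have "card (f ` {..n}) = Suc n" by (simp add: card_image)
    moreover have "dim (f ` {..n}) \<le> n"
      unfolding n_def using dim_subset_UNIV dimension_def by metis
    ultimately have "dependent (f ` {..n})"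
      using independent_bound_general[of "f ` {..n}"] by auto
    then obtain u where u: "\<exists>v\<in>f ` {..n}. u v \<noteq> 0" "(\<Sum>v\<in>f ` {..n}. u v \<odot> v) = 0"
      using dependent_finite[of "f ` {..n}"] by auto
    have "(\<Sum>i\<le>n. (u \<circ> f) i \<odot> f i) = 0"
      using u(2) by (simp add: sum.reindex[OF True])
    moreover have "\<exists>i\<le>n. (u \<circ> f) i \<noteq> 0" using u(1) by auto
    ultimately show ?thesis by metis
  next
    case False
    then obtain i j where ij: "i \<le> n" "j \<le> n" "i \<noteq> j" "f i = f j"
      by (auto simp: inj_on_def)
    define u where "u k = (if k = i then 1 else if k = j then -1 else 0 :: complex)" for k
    have "(\<Sum>k\<le>n. u k \<odot> f k) = (\<Sum>k\<in>{i,j}. u k \<odot> f k)"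
      by (rule sum.mono_neutral_right) (use ij in \<open>auto simp: u_def\<close>)
    also have "\<dots> = 0" using ij by (simp add: u_def)
    finally show ?thesis using ij(1) by (intro exI[of _ n] exI[of _ u]) (auto simp: u_def)
  qed
qed

definition poly_action :: "('g \<Rightarrow> 'g) \<Rightarrow> complex poly \<Rightarrow> 'g \<Rightarrow> 'g" where
  "poly_action T p v = (\<Sum>i\<le>degree p. coeff p i \<odot> (T ^^ i) v)"

lemma poly_action_eq:
  assumes "degree p \<le> n"
  shows "poly_action T p v = (\<Sum>i\<le>n. coeff p i \<odot> (T ^^ i) v)"
  unfolding poly_action_def
  by (rule sum.mono_neutral_left) (use assms in \<open>auto simp: coeff_eq_0\<close>)

lemma poly_action_linear_factor:
  assumes T: "Vector_Spaces.linear scale scale T"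
  shows "poly_action T ([:- c, 1:] * q) v = T (poly_action T q v) - c \<odot> poly_action T q v"
proof -
  interpret T: Vector_Spaces.linear scale scale T by (rule T)
  define n where "n = degree q"
  have deg: "degree ([:- c, 1:] * q) \<le> Suc n"
    unfolding n_def by (rule order_trans[OF degree_mult_le]) simp
  have "poly_action T ([:- c, 1:] * q) v
      = (\<Sum>i\<le>Suc n. (coeff (pCons 0 q) i - c * coeff q i) \<odot> (T ^^ i) v)"
    by (subst poly_action_eq[OF deg]) (simp add: algebra_simps)
  also have "\<dots> = (\<Sum>i\<le>Suc n. coeff (pCons 0 q) i \<odot> (T ^^ i) v)
      - c \<odot> (\<Sum>i\<le>Suc n. coeff q i \<odot> (T ^^ i) v)"
    by (simp only: scale_left_diff_distrib sum_subtractf scale_sum_right scale_scale)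
  also have "(\<Sum>i\<le>Suc n. coeff (pCons 0 q) i \<odot> (T ^^ i) v) = T (poly_action T q v)"
    by (subst sum.atMost_Suc_shift) (simp add: poly_action_def n_def T.sum T.scale)
  also have "(\<Sum>i\<le>Suc n. coeff q i \<odot> (T ^^ i) v) = poly_action T q v"
    by (rule poly_action_eq[symmetric]) (simp add: n_def)
  finally show ?thesis .
qed

text \<open>
  A polynomial of least degree annihilating some nonzero vector splits off a linear factor over
  the complex numbers; by minimality the cofactor sends the vector to something nonzero, and that
  is an eigenvector.  It stays in every invariant subspace that contains the vector.
\<close>
lemma exists_eigenvector:
  assumes T: "Vector_Spaces.linear scale scale T" and W: "subspace W" "T ` W \<subseteq> W" "W \<noteq> {0}"
  shows "\<exists>v\<in>W. \<exists>c. v \<noteq> 0 \<and> T v = c \<odot> v"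
proof -
  have "0 \<in> W" using W(1) by (rule subspace_0)
  with W(3) obtain v where v: "v \<in> W" "v \<noteq> 0" by auto
  define ann where "ann p \<longleftrightarrow> p \<noteq> 0 \<and> poly_action T p v = 0" for p
  have "\<exists>p. ann p"
  proof -
    obtain n u where u: "\<exists>i\<le>n. u i \<noteq> 0" "(\<Sum>i\<le>n. u i \<odot> (T ^^ i) v) = 0"
      using exists_linear_relation[of "\<lambda>i. (T ^^ i) v"] by auto
    define p where "p = (\<Sum>i\<le>n. monom (u i) i)"
    have coeff_p: "coeff p k = (if k \<le> n then u k else 0)" for k
      by (simp add: p_def coeff_sum)
    have "degree p \<le> n" by (rule degree_le) (simp add: coeff_p)
    then have "poly_action T p v = 0" using u(2) by (simp add: poly_action_eq coeff_p)
    moreover have "p \<noteq> 0" using u(1) coeff_p by (metis coeff_0)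
    ultimately show ?thesis unfolding ann_def by blast
  qed
  then obtain p where p: "ann p" and least: "\<And>q. ann q \<Longrightarrow> degree p \<le> degree q"
    using ex_has_least_nat[of ann _ degree] by blast
  have "degree p \<noteq> 0"
  proof
    assume d: "degree p = 0"
    then have "poly_action T p v = coeff p 0 \<odot> v" by (simp add: poly_action_def)
    with p v(2) have "coeff p 0 = 0" by (simp add: ann_def)
    with d p show False by (simp add: ann_def) (metis leading_coeff_0_iff)
  qed
  then have "\<not> constant (poly p)" by (simp add: constant_degree)
  then obtain c where "poly p c = 0" using fundamental_theorem_of_algebra by blast
  then obtain q where q: "p = [:- c, 1:] * q" by (auto simp: poly_eq_0_iff_dvd elim: dvdE)
  have q0: "q \<noteq> 0" using p q by (auto simp: ann_def)
  then have "degree q < degree p"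
    using degree_mult_eq[of "[:- c, 1:]" q] by (simp add: q del: mult_pCons_left)
  then have nz: "poly_action T q v \<noteq> 0" using least[of q] q0 by (auto simp: ann_def)
  have pow: "(T ^^ i) v \<in> W" for i by (induction i) (use v W(2) in auto)
  have inW: "poly_action T q v \<in> W"
    unfolding poly_action_def by (intro subspace_sum subspace_scale W(1) pow)
  have "T (poly_action T q v) = c \<odot> poly_action T q v"
    using p poly_action_linear_factor[OF T, of c q v] by (simp add: ann_def q)
  with nz inW show ?thesis by blast
qed

text \<open>
  An invariant complement of the span of all integral eigenvectors would, if nonzero, contain a
  further eigenvector; hence these eigenvectors span, and a basis can be chosen among them.
\<close>
lemma semisimple_integral_eigenbasis:
  assumes ss: "semisimple_endomorphism scale T" and int: "integral_eigenvalues scale T"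
  shows "\<exists>E deg. complex_space scale E \<and> (\<forall>b\<in>E. T b = of_int (deg b) \<odot> b)"
proof -
  define S where "S = {v. \<exists>j::int. T v = of_int j \<odot> v}"
  interpret T: Vector_Spaces.linear scale scale T
    using ss by (simp add: semisimple_endomorphism_def)
  have T: "Vector_Spaces.linear scale scale T" by (rule T.linear_axioms)
  have TS: "T ` S \<subseteq> span S"
  proof
    fix w assume "w \<in> T ` S"
    then obtain v j where "v \<in> S" "w = of_int j \<odot> v" by (auto simp: S_def)
    then show "w \<in> span S" by (simp add: span_scale span_base)
  qed
  then have "T ` span S \<subseteq> span S"
    using T.span_image[of S] span_mono[of "T ` S" "span S"] by (simp add: span_span)
  then obtain W' where W': "subspace W'" "T ` W' \<subseteq> W'" "span S \<inter> W' = {0}"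
      and sum: "\<And>v. \<exists>w\<in>span S. \<exists>w'\<in>W'. v = w + w'"
    using ss subspace_span[of S] unfolding semisimple_endomorphism_def by metis
  have "W' = {0}"
  proof (rule ccontr)
    assume "W' \<noteq> {0}"
    then obtain v c where v: "v \<in> W'" "v \<noteq> 0" "T v = c \<odot> v"
      using exists_eigenvector[OF T W'(1,2)] by blast
    with int obtain j :: int where "c = of_int j"
      unfolding integral_eigenvalues_def by (metis Ints_cases)
    with v have "v \<in> S" by (auto simp: S_def)
    with v W'(3) show False using span_base by blast
  qed
  with sum have full: "span S = UNIV" by fastforce
  obtain E where E: "E \<subseteq> S" "independent E" "S \<subseteq> span E"
    using maximal_independent_subset[of S] by blast
  have "span E = UNIV"
    using span_mono[OF E(3)] full by (simp add: span_span top.extremum_unique)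
  then have "complex_space scale E"
    by unfold_locales (use E(2) finiteI_independent in auto)
  moreover have "\<forall>b\<in>E. \<exists>j::int. T b = of_int j \<odot> b" using E(1) by (auto simp: S_def)
  then obtain deg :: "'g \<Rightarrow> int" where "\<forall>b\<in>E. T b = of_int (deg b) \<odot> b"
    using bchoice by metis
  ultimately show ?thesis by blast
qed

end

text \<open>
  The grading is carried by a homogeneous basis \<open>Basis\<close>, on which \<open>deg\<close> gives the degrees.  Projections and the cocharacter then become explicit linear maps in coordinates.
\<close>
locale graded_space = complex_space scale Basis
  for scale :: "complex \<Rightarrow> 'g::ab_group_add \<Rightarrow> 'g" (infixr "\<odot>" 75) and Basis :: "'g set" +
  fixes deg :: "'g \<Rightarrow> int"
begin

definition part :: "int \<Rightarrow> 'g set" where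
  "part j = {v. \<forall>b\<in>Basis. deg b \<noteq> j \<longrightarrow> crd v b = 0}"

definition mult :: "int \<Rightarrow> nat" where
  "mult j = card {b\<in>Basis. deg b = j}"

definition proj :: "int \<Rightarrow> 'g \<Rightarrow> 'g" where
  "proj j v = (\<Sum>b | b \<in> Basis \<and> deg b = j. crd v b \<odot> b)"

definition torus :: "complex \<Rightarrow> 'g \<Rightarrow> 'g" where
  "torus x v = (\<Sum>b\<in>Basis. (x powi (2 * deg b - 1) * crd v b) \<odot> b)"

lemma crd_proj: "b \<in> Basis \<Longrightarrow> crd (proj j v) b = (if deg b = j then crd v b else 0)"
  unfolding proj_def by (subst crd_sum_Basis) auto

lemma crd_torus: "b \<in> Basis \<Longrightarrow> crd (torus x v) b = x powi (2 * deg b - 1) * crd v b"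
  unfolding torus_def by (subst crd_sum_Basis) auto

lemma subspace_part: "subspace (part j)"
  unfolding subspace_def part_def by auto

lemma proj_in_part: "proj j v \<in> part j"
  by (simp add: part_def crd_proj)

lemma proj_part: "v \<in> part j \<Longrightarrow> proj j v = v"
  by (rule crd_eqI) (auto simp: part_def crd_proj)

lemma linear_proj: "Vector_Spaces.linear scale scale (proj j)"
  by (rule linear_endoI; rule crd_eqI) (auto simp: crd_proj)

lemma sum_proj: "(\<Sum>j\<in>deg ` Basis. proj j v) = v"
  by (rule crd_eqI) (auto simp: crd_sum crd_proj finite_Basis)

lemma Basis_in_part: "b \<in> Basis \<Longrightarrow> b \<in> part (deg b)"
  by (auto simp: part_def crd_Basis)

lemma proj_outside: "j \<notin> deg ` Basis \<Longrightarrow> proj j v = 0"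
  by (rule crd_eqI) (auto simp: crd_proj)

lemma finite_mult_support: "finite {j. mult j \<noteq> 0}"
proof (rule finite_subset)
  show "{j. mult j \<noteq> 0} \<subseteq> deg ` Basis"
    by (auto simp: mult_def card_eq_0_iff)
  show "finite (deg ` Basis)" by (simp add: finite_Basis)
qed

lemma part_eq_span: "part j = span {b\<in>Basis. deg b = j}"
proof
  show "part j \<subseteq> span {b\<in>Basis. deg b = j}"
  proof
    fix v assume "v \<in> part j"
    then have "v = proj j v" by (simp add: proj_part)
    then show "v \<in> span {b\<in>Basis. deg b = j}"
      by (metis (no_types, lifting) proj_def span_base span_scale span_sum)
  qed
  show "span {b\<in>Basis. deg b = j} \<subseteq> part j"
    by (rule span_minimal) (auto simp: subspace_part Basis_in_part)
qed

lemma dim_part: "dim (part j) = mult j"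
  unfolding part_eq_span mult_def dim_span
  by (rule dim_eq_card_independent, rule independent_mono[OF independent_Basis]) auto

lemma part_trivial: "mult j = 0 \<Longrightarrow> v \<in> part j \<Longrightarrow> v = 0"
  by (rule crd_eqI) (auto simp: part_def mult_def finite_Basis)

lemma linear_torus: "Vector_Spaces.linear scale scale (torus x)"
  by (rule linear_endoI; rule crd_eqI) (auto simp: crd_torus algebra_simps)

lemma torus_part: "v \<in> part j \<Longrightarrow> torus x v = x powi (2 * j - 1) \<odot> v"
  by (rule crd_eqI) (auto simp: crd_torus part_def)

lemma torus_mult: "torus (x * y) = torus x \<circ> torus y"
  by (rule ext, rule crd_eqI) (simp add: crd_torus power_int_mult_distrib)

lemma torus_one: "torus 1 = id"
  by (rule ext, rule crd_eqI) (simp add: crd_torus)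

lemma torus_unique:
  assumes L: "Vector_Spaces.linear scale scale L"
    and part: "\<And>j v. v \<in> part j \<Longrightarrow> L v = x powi (2 * j - 1) \<odot> v"
  shows "L = torus x"
proof
  fix v
  interpret L: Vector_Spaces.linear scale scale L by (rule L)
  have "L v = (\<Sum>b\<in>Basis. crd v b \<odot> L b)"
    by (subst crd_expansion[symmetric]) (simp only: L.sum L.scale)
  also have "\<dots> = (\<Sum>b\<in>Basis. (x powi (2 * deg b - 1) * crd v b) \<odot> b)"
    by (rule sum.cong) (auto simp: part[OF Basis_in_part] mult.commute)
  finally show "L v = torus x v" by (simp add: torus_def)
qed

text \<open>
  Identifies the grading by a basis of eigenvectors with the basis-free one by eigenspaces.
\<close>
lemma eigenspace_eq_part:
  assumes T: "Vector_Spaces.linear scale scale T"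
    and eig: "\<And>b. b \<in> Basis \<Longrightarrow> T b = of_int (deg b) \<odot> b"
  shows "{v. T v = of_int j \<odot> v} = part j"
proof -
  interpret T: Vector_Spaces.linear scale scale T by (rule T)
  have "T v = (\<Sum>b\<in>Basis. (crd v b * of_int (deg b)) \<odot> b)" for v
    by (subst crd_expansion[symmetric, of v]) (simp add: T.sum T.scale eig del: crd_expansion)
  then have crd_T: "crd (T v) b = crd v b * of_int (deg b)" if "b \<in> Basis" for v b
    using that by (simp add: crd_sum_Basis)
  have "T v = of_int j \<odot> v \<longleftrightarrow> (\<forall>b\<in>Basis. crd v b * of_int (deg b) = of_int j * crd v b)" for v
    using crd_T crd_eqI[of "T v" "of_int j \<odot> v"] by (metis crd_scale)
  also have "\<dots> v \<longleftrightarrow> v \<in> part j" for v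
    by (auto simp: part_def)
  finally show ?thesis by blast
qed

end

section \<open>Graded symplectic spaces\<close>

locale symplectic_space = complex_space scale Basis
  for scale :: "complex \<Rightarrow> 'g::ab_group_add \<Rightarrow> 'g" (infixr "\<odot>" 75) and Basis :: "'g set" +
  fixes om :: "'g \<Rightarrow> 'g \<Rightarrow> complex"
  assumes om_linear_left: "Vector_Spaces.linear scale (*) (\<lambda>x. om x y)"
    and om_linear_right: "Vector_Spaces.linear scale (*) (om x)"
    and om_alternating: "om x x = 0"
    and om_nondegenerate: "(\<And>y. om x y = 0) \<Longrightarrow> x = 0"
begin

lemma om_simps [simp]:
  "om (v + v') w = om v w + om v' w" "om (c \<odot> v) w = c * om v w"
  "om v (w + w') = om v w + om v w'" "om v (c \<odot> w) = c * om v w"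
  using om_linear_left[of w] om_linear_right[of v] by (auto simp: Vector_Spaces.linear_iff)

lemma om_zero [simp]: "om 0 w = 0" "om v 0 = 0"
  using om_simps(2)[of 0 0 w] om_simps(4)[of v 0 0] by simp_all

lemma om_sum_left: "om (sum f S) w = (\<Sum>s\<in>S. om (f s) w)"
  by (induction S rule: infinite_finite_induct) auto

lemma om_sum_right: "om v (sum f S) = (\<Sum>s\<in>S. om v (f s))"
  by (induction S rule: infinite_finite_induct) auto

lemma om_swap: "om w v = - om v w"
proof -
  have "0 = om (v + w) (v + w)" by (simp only: om_alternating)
  also have "\<dots> = om v v + om v w + (om w v + om w w)" by (simp only: om_simps add_ac)
  also have "\<dots> = om v w + om w v" by (simp only: om_alternating) simp
  finally show ?thesis by (metis add_eq_0_iff)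
qed

lemma om_expansion:
  "om v w = (\<Sum>b\<in>Basis. \<Sum>c\<in>Basis. crd v b * crd w c * om b c)"
proof -
  have "om v w = om (\<Sum>b\<in>Basis. crd v b \<odot> b) (\<Sum>b\<in>Basis. crd w b \<odot> b)"
    by (simp only: crd_expansion)
  also have "\<dots> = (\<Sum>b\<in>Basis. \<Sum>c\<in>Basis. crd v b * crd w c * om b c)"
    by (simp only: om_sum_left) (simp add: om_sum_right sum_distrib_left mult_ac)
  finally show ?thesis .
qed

lemma om_eqI:
  assumes "\<And>b. b \<in> Basis \<Longrightarrow> om b y = om b z"
  shows "y = z"
proof -
  have "om x y = om x z" for x
    by (subst (1 2) crd_expansion[symmetric, of x]) (simp add: om_sum_left assms)
  then have "om (y - z) x = 0" for x
    using om_swap[of y x] om_swap[of z x] om_simps(1)[of "y - z" z x] by simp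
  then have "y - z = 0" by (rule om_nondegenerate)
  then show ?thesis by simp
qed

text \<open>
  In finite dimension the injective map that sends \<open>y\<close> to the functional \<open>om _ y\<close> is surjective;
  the proof encodes the functional by its vector of values on the basis.
\<close>
lemma representing_vector:
  assumes f: "Vector_Spaces.linear scale (*) f"
  shows "\<exists>y. \<forall>x. om x y = f x"
proof -
  define T where "T y = (\<Sum>b\<in>Basis. om b y \<odot> b)" for y
  have crd_T: "crd (T y) b = om b y" if "b \<in> Basis" for y b
    unfolding T_def using that by (subst crd_sum_Basis) auto
  have T: "Vector_Spaces.linear scale scale T"
    by (rule linear_endoI; rule crd_eqI) (auto simp: crd_T)
  have "inj T"
    by (rule injI, rule om_eqI) (metis crd_T)
  then have "surj T" using T linear_inj_imp_surj by blast
  then obtain y where "T y = (\<Sum>b\<in>Basis. f b \<odot> b)" by (metis surjD)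
  then have y: "om b y = f b" if "b \<in> Basis" for b
    using that crd_T[of b y] by (simp add: crd_sum_Basis)
  interpret f: Vector_Spaces.linear scale "(*)" f by (rule f)
  have "om x y = f x" for x
    by (subst (1 2) crd_expansion[symmetric, of x]) (simp add: om_sum_left f.sum f.scale y)
  then show ?thesis by blast
qed

text \<open>
  A linear map that preserves a nondegenerate form has no kernel, so bijectivity is automatic.
\<close>
lemma in_symplectic_groupI:
  assumes L: "Vector_Spaces.linear scale scale L" and om: "\<And>u v. om (L u) (L v) = om u v"
  shows "L \<in> carrier (symplectic_group scale om)"
proof -
  interpret L: Vector_Spaces.linear scale scale L by (rule L)
  have "u = 0" if "L u = 0" for u
    by (rule om_nondegenerate) (metis om that om_zero(1))
  then have "inj L" using L.inj_iff_eq_0 by blast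
  then have "bij L" using L linear_inj_imp_surj by (auto simp: bij_def)
  then show ?thesis using L om by (simp add: symplectic_group_def)
qed

end

locale graded_symplectic = graded_space scale Basis deg + symplectic_space scale Basis om
  for scale :: "complex \<Rightarrow> 'g::ab_group_add \<Rightarrow> 'g" (infixr "\<odot>" 75) and Basis :: "'g set"
    and deg :: "'g \<Rightarrow> int" and om :: "'g \<Rightarrow> 'g \<Rightarrow> complex" +
  assumes om_homogeneous: "b \<in> Basis \<Longrightarrow> c \<in> Basis \<Longrightarrow> deg b + deg c \<noteq> 1 \<Longrightarrow> om b c = 0"
begin

lemma om_part:
  assumes "v \<in> part j" "w \<in> part k" "j + k \<noteq> 1"
  shows "om v w = 0"
proof -
  have "crd v b * crd w c * om b c = 0" if "b \<in> Basis" "c \<in> Basis" for b c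
    using assms that om_homogeneous[of b c] by (cases "deg b = j"; cases "deg c = k") (auto simp: part_def)
  then show ?thesis by (subst om_expansion) (intro sum.neutral ballI)
qed

lemma om_torus:
  assumes "x \<noteq> 0"
  shows "om (torus x v) (torus x w) = om v w"
proof -
  have "crd (torus x v) b * crd (torus x w) c * om b c = crd v b * crd w c * om b c"
    if "b \<in> Basis" "c \<in> Basis" for b c
  proof (cases "deg b + deg c = 1")
    case True
    then have "(2 * deg b - 1) + (2 * deg c - 1) = 0" by simp
    then have "x powi (2 * deg b - 1) * x powi (2 * deg c - 1) = 1"
      using assms by (metis power_int_0_right power_int_add)
    then show ?thesis using that by (simp add: crd_torus algebra_simps)
  qed (use that om_homogeneous[of b c] in simp)
  then show ?thesis
    unfolding om_expansion[of "torus x v"] om_expansion[of v] by (intro sum.cong refl)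
qed

text \<open>
  The basis dual to \<open>Basis\<close> with respect to the form, in the right argument (see \<open>om_dual\<close>).
\<close>
definition dual :: "'g \<Rightarrow> 'g" where
  "dual b = (SOME y. \<forall>x. om x y = crd x b)"

lemma om_dual: "om x (dual b) = crd x b"
  using someI_ex[OF representing_vector[OF linear_crd[of b]]] by (simp add: dual_def)

text \<open>
  Discarding the components of the dual vector of the other degrees does not change its pairing
  with any basis vector, because those components only pair with basis vectors of the wrong degree.
\<close>
lemma dual_in_part:
  assumes b: "b \<in> Basis"
  shows "dual b \<in> part (1 - deg b)"
proof -
  let ?y = "proj (1 - deg b) (dual b)"
  have "om c ?y = om c (dual b)" if c: "c \<in> Basis" for c
  proof (cases "deg c = deg b")
    case True
    have "om c (dual b) = (\<Sum>j\<in>deg ` Basis. om c (proj j (dual b)))"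
      by (subst (1) sum_proj[symmetric, of "dual b"]) (simp add: om_sum_right)
    also have "\<dots> = (\<Sum>j\<in>deg ` Basis. if j = 1 - deg b then om c ?y else 0)"
      by (rule sum.cong) (use om_part[OF Basis_in_part[OF c] proj_in_part] True in \<open>auto\<close>)
    also have "\<dots> = om c ?y"
    proof (cases "1 - deg b \<in> deg ` Basis")
      case False
      then have "{a \<in> Basis. deg a = 1 - deg b} = {}" by force
      then have "?y = 0" unfolding proj_def by (metis (no_types, lifting) sum.empty)
      then have "om c ?y = 0" by simp
      then show ?thesis by (simp only: if_cancel sum.neutral_const)
    qed (simp add: finite_Basis)
    finally show ?thesis by simp
  next
    case False
    then show ?thesis
      using om_part[OF Basis_in_part[OF c] proj_in_part, of "1 - deg b" "dual b"] b c
      by (auto simp: om_dual crd_Basis)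
  qed
  then have "?y = dual b" by (rule om_eqI)
  then show ?thesis using proj_in_part by metis
qed

lemma dual_expansion: "y = (\<Sum>b\<in>Basis. om b y \<odot> dual b)"
proof (rule om_eqI)
  fix c assume c: "c \<in> Basis"
  have "om c (\<Sum>b\<in>Basis. om b y \<odot> dual b) = (\<Sum>b\<in>Basis. if b = c then om c y else 0)"
    unfolding om_sum_right
    by (rule sum.cong) (use c in \<open>auto simp: om_dual crd_Basis\<close>)
  then show "om c y = om c (\<Sum>b\<in>Basis. om b y \<odot> dual b)"
    using c by (simp add: finite_Basis)
qed

lemma part_in_span_dual:
  assumes "y \<in> part (1 - j)"
  shows "y \<in> span (dual ` {b\<in>Basis. deg b = j})"
proof -
  have "om b y \<odot> dual b \<in> span (dual ` {b\<in>Basis. deg b = j})" if b: "b \<in> Basis" for b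
  proof (cases "deg b = j")
    case True
    then show ?thesis using b by (intro span_scale span_base) auto
  next
    case False
    then have "om b y = 0" using om_part[OF Basis_in_part[OF b] assms] by auto
    then show ?thesis by (simp add: span_zero)
  qed
  then show ?thesis by (subst dual_expansion) (rule span_sum)
qed

lemma mult_symmetric: "mult (1 - j) = mult j"
proof -
  have le: "mult (1 - k) \<le> mult k" for k
  proof -
    have fin: "finite {b\<in>Basis. deg b = k}" by (simp add: finite_Basis)
    have "mult (1 - k) \<le> card (dual ` {b\<in>Basis. deg b = k})"
      unfolding dim_part[symmetric]
      by (rule dim_le_card) (use part_in_span_dual fin in auto)
    also have "\<dots> \<le> mult k" unfolding mult_def by (rule card_image_le[OF fin])
    finally show ?thesis .
  qed
  show ?thesis using le[of j] le[of "1 - j"] by simp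
qed

lemma torus_hom: 
  assumes "\<And>x. x \<noteq> 0 \<Longrightarrow> lam x = torus x"
  shows "lam \<in> hom mult_group (symplectic_group scale om)"
proof (rule homI)
  fix x assume "x \<in> carrier mult_group"
  then show "lam x \<in> carrier (symplectic_group scale om)"
    using assms by (auto simp: mult_group_def intro!: in_symplectic_groupI linear_torus om_torus)
next
  fix x y assume "x \<in> carrier mult_group" "y \<in> carrier mult_group"
  then show "lam (x \<otimes>\<^bsub>mult_group\<^esub> y) = lam x \<otimes>\<^bsub>symplectic_group scale om\<^esub> lam y"
    using assms by (simp add: mult_group_def symplectic_group_def torus_mult)
qed

end

section \<open>Weights of an algebraic representation\<close>

definition upper_unipotent :: "complex \<Rightarrow> complex^2^2" where
  "upper_unipotent z = vector [vector [1, z], vector [0, 1]]"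

definition lower_unipotent :: "complex \<Rightarrow> complex^2^2" where
  "lower_unipotent z = vector [vector [1, 0], vector [z, 1]]"

lemma diag_torus_nth [simp]:
  "diag_torus x $ 1 $ 1 = x" "diag_torus x $ 1 $ 2 = 0"
  "diag_torus x $ 2 $ 1 = 0" "diag_torus x $ 2 $ 2 = inverse x"
  by (simp_all add: diag_torus_def)

lemma upper_unipotent_nth [simp]:
  "upper_unipotent z $ 1 $ 1 = 1" "upper_unipotent z $ 1 $ 2 = z"
  "upper_unipotent z $ 2 $ 1 = 0" "upper_unipotent z $ 2 $ 2 = 1"
  by (simp_all add: upper_unipotent_def)

lemma lower_unipotent_nth [simp]:
  "lower_unipotent z $ 1 $ 1 = 1" "lower_unipotent z $ 1 $ 2 = 0"
  "lower_unipotent z $ 2 $ 1 = z" "lower_unipotent z $ 2 $ 2 = 1"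
  by (simp_all add: lower_unipotent_def)

lemma det_generators [simp]:
  "x \<noteq> 0 \<Longrightarrow> det (diag_torus x) = 1" "det (upper_unipotent z) = 1" "det (lower_unipotent z) = 1"
  by (simp_all add: det_2)

lemma unipotent_zero: "upper_unipotent 0 = mat 1" "lower_unipotent 0 = mat 1"
  by (simp_all add: vec_eq_iff forall_2 mat_def)

lemma diag_torus_one: "diag_torus 1 = mat 1"
  by (simp add: vec_eq_iff forall_2 mat_def)

lemma torus_conj_upper:
  "x \<noteq> 0 \<Longrightarrow> diag_torus x ** upper_unipotent z = upper_unipotent (x\<^sup>2 * z) ** diag_torus x"
  by (simp add: vec_eq_iff forall_2 matrix_matrix_mult_def sum_2 power2_eq_square)

lemma torus_conj_lower:
  "x \<noteq> 0 \<Longrightarrow> diag_torus (inverse x) ** lower_unipotent z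
     = lower_unipotent (x\<^sup>2 * z) ** diag_torus (inverse x)"
  by (simp add: vec_eq_iff forall_2 matrix_matrix_mult_def sum_2 power2_eq_square)

text \<open>
  This is the integrated form of the relation \<open>[e,f] = h\<close>: exchanging an upper with a lower
  unipotent matrix costs torus factors.  The parameter \<open>x\<^sup>2 - 1\<close> distributes this cost equally to
  both sides, so that no denominators occur and only one lower unipotent matrix is involved.
\<close>
lemma unipotent_exchange:
  "x \<noteq> 0 \<Longrightarrow> upper_unipotent (x\<^sup>2 - 1) ** lower_unipotent 1
     = diag_torus x ** (lower_unipotent 1 ** (upper_unipotent (x\<^sup>2 - 1) ** diag_torus x))"
  by (simp add: vec_eq_iff forall_2 matrix_matrix_mult_def sum_2 power2_eq_square field_simps)

text \<open>
  Algebraicity enters the study of the weights through this lemma, as continuity of the unipotent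
  one-parameter groups at \<open>0\<close>.
\<close>
lemma matrix_polynomial_isCont:
  assumes "matrix_polynomial p" and M: "\<And>i j. isCont (\<lambda>z. M z $ i $ j) a"
  shows "isCont (\<lambda>z. p (M z)) a"
  using assms(1) by induction (auto intro!: continuous_intros M)

text \<open>
  Picks out the component of degree \<open>1\<close> from the expansion of a unipotent one-parameter group,
  whose components of negative degree vanish.
\<close>
lemma has_derivative_at_0_truncated_power:
  "((\<lambda>z. (if n < 0 then 0 else z ^ nat n) * c) has_field_derivative (if n = 1 then c else 0))
     (at (0::complex))"
proof (cases "n < 0")
  case False
  then have "((\<lambda>z. z ^ nat n * c) has_field_derivative (of_nat (nat n) * 0 ^ (nat n - 1) * c)) (at 0)"
    by (auto intro!: derivative_eq_intros)
  moreover have "of_nat (nat n) * 0 ^ (nat n - 1) * c = (if n = 1 then c else 0)"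
    using False by (cases "n = 0"; cases "n = 1") (auto simp: power_0_left)
  ultimately show ?thesis using False by simp
qed simp

locale sl2_extension = graded_symplectic scale Basis deg om
  for scale :: "complex \<Rightarrow> 'g::ab_group_add \<Rightarrow> 'g" (infixr "\<odot>" 75) and Basis :: "'g set"
    and deg :: "'g \<Rightarrow> int" and om :: "'g \<Rightarrow> 'g \<Rightarrow> complex" +
  fixes rho :: "complex^2^2 \<Rightarrow> 'g \<Rightarrow> 'g"
  assumes algebraic: "algebraic_SL2_hom scale om rho"
    and rho_torus: "x \<noteq> 0 \<Longrightarrow> rho (diag_torus x) = torus x"
begin

lemma rho_mult: "det A = 1 \<Longrightarrow> det B = 1 \<Longrightarrow> rho (A ** B) v = rho A (rho B v)"
  using algebraic unfolding algebraic_SL2_hom_def hom_def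
  by (auto simp: SL2_def symplectic_group_def)

lemma linear_rho: "det A = 1 \<Longrightarrow> Vector_Spaces.linear scale scale (rho A)"
  using algebraic unfolding algebraic_SL2_hom_def hom_def
  by (auto simp: SL2_def symplectic_group_def)

lemma rho_one: "rho (mat 1) v = v"
  using rho_torus[of 1] by (simp add: diag_torus_one torus_one)

lemma rho_sum: "det A = 1 \<Longrightarrow> rho A (sum g S) = (\<Sum>s\<in>S. rho A (g s))"
  using linear_rho[of A] Vector_Spaces.linear.axioms(3) module_hom.sum by metis

lemma rho_scale: "det A = 1 \<Longrightarrow> rho A (c \<odot> v) = c \<odot> rho A v"
  using linear_rho[of A] by (simp add: Vector_Spaces.linear_iff)

lemma rho_isCont:
  assumes "\<And>z. det (M z) = 1" "\<And>i j. isCont (\<lambda>z. M z $ i $ j) a"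
  shows "isCont (\<lambda>z. crd (rho (M z) v) b) a"
proof -
  obtain p where p: "matrix_polynomial p" "\<And>A. A \<in> carrier SL2 \<Longrightarrow> crd (rho A v) b = p A"
    using algebraic linear_crd[of b] unfolding algebraic_SL2_hom_def by meson
  have "(\<lambda>z. crd (rho (M z) v) b) = (\<lambda>z. p (M z))"
    using p(2) assms(1) by (auto simp: SL2_def)
  then show ?thesis using matrix_polynomial_isCont[OF p(1) assms(2)] by simp
qed

text \<open>
  Conjugation by the torus scales the parameter of the group by \<open>x\<^sup>2\<close> and the coordinate by
  \<open>x\<close> to twice the degree shift, so that for \<open>z \<noteq> 0\<close> the coordinate is homogeneous in \<open>z\<close> of that
  degree.  Continuity at \<open>0\<close> excludes negative degrees and fixes the degree \<open>0\<close> part.  The sign \<open>e\<close>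
  treats upper and lower unipotent matrices together.
\<close>
lemma unipotent_coordinates:
  assumes det: "\<And>z. det (M z) = 1" and M0: "M 0 = mat 1"
    and cont: "\<And>i j. isCont (\<lambda>z. M z $ i $ j) 0"
    and conj: "\<And>x z. x \<noteq> 0 \<Longrightarrow>
      diag_torus (x powi e) ** M z = M (x\<^sup>2 * z) ** diag_torus (x powi e)"
    and e: "e = 1 \<or> e = -1"
    and b: "b \<in> Basis" and v: "v \<in> part j"
    and n: "n = e * (deg b - j)"
  shows "crd (rho (M z) v) b = (if n < 0 then 0 else z ^ nat n * crd (rho (M 1) v) b)"
    and "n = 0 \<Longrightarrow> crd (rho (M 1) v) b = crd v b"
proof -
  define g where "g z = crd (rho (M z) v) b" for z
  have g0: "g 0 = crd v b" by (simp add: g_def M0 rho_one)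
  have lim: "(g \<longlongrightarrow> g 0) (at 0)"
    using rho_isCont[OF det cont] by (simp add: g_def[abs_def] isCont_def)
  have power: "g z = z powi n * g 1" if z: "z \<noteq> 0" for z
  proof -
    define x where "x = csqrt z"
    define y where "y = x powi e"
    have x: "x \<noteq> 0" "x\<^sup>2 = z" using z by (auto simp: x_def)
    have y: "y \<noteq> 0" using x by (auto simp: y_def)
    have "torus y (rho (M 1) v) = rho (M z) (torus y v)"
      using rho_mult[of "diag_torus y" "M 1" v] rho_mult[of "M z" "diag_torus y" v]
        conj[OF x(1), of 1] det x y by (simp add: y_def[symmetric] rho_torus)
    then have "crd (torus y (rho (M 1) v)) b = crd (rho (M z) (torus y v)) b" by simp
    then have "y powi (2 * deg b - 1) * g 1 = y powi (2 * j - 1) * g z"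
      using det by (simp add: crd_torus b torus_part[OF v] rho_scale g_def)
    moreover have "y powi (2 * deg b - 1) = y powi (2 * j - 1) * z powi n"
    proof -
      have "z powi n = x powi (2 * n)" using x by (simp add: power_int_mult)
      also have "\<dots> = y powi (2 * (deg b - j))"
        unfolding y_def n power_int_mult[symmetric] by (simp add: mult_ac)
      finally have "y powi (2 * j - 1) * z powi n = y powi (2 * j - 1 + 2 * (deg b - j))"
        using power_int_add[OF disjI1[OF y], of "2 * j - 1" "2 * (deg b - j)"] by argo
      then show ?thesis by (simp add: algebra_simps)
    qed
    ultimately show ?thesis using y by simp
  qed
  show 0: "crd (rho (M 1) v) b = crd v b" if "n = 0"
  proof -
    have const: "g z = g 1" if "z \<noteq> 0" for z using power[OF that] \<open>n = 0\<close> by simp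
    have "eventually (\<lambda>z. z \<noteq> 0) (at (0::complex))" by (rule eventually_neq_at_within)
    then have "eventually (\<lambda>z. g z = g 1) (at 0)" by eventually_elim (rule const)
    then have "(g \<longlongrightarrow> g 1) (at 0)" by (rule tendsto_eventually)
    with lim have "g 1 = g 0" using tendsto_unique[OF at_neq_bot] by blast
    then show ?thesis using g0 by (simp add: g_def)
  qed
  have neg: "g 1 = 0" if "n < 0"
  proof -
    have const: "z ^ nat (- n) * g z = g 1" if "z \<noteq> 0" for z
      unfolding power[OF that] using \<open>n < 0\<close> that
      by (simp add: power_int_def power_inverse)
    have "eventually (\<lambda>z. z \<noteq> 0) (at (0::complex))" by (rule eventually_neq_at_within)
    then have "eventually (\<lambda>z. z ^ nat (- n) * g z = g 1) (at 0)"
      by eventually_elim (rule const)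
    then have "((\<lambda>z. z ^ nat (- n) * g z) \<longlongrightarrow> g 1) (at 0)" by (rule tendsto_eventually)
    moreover have "((\<lambda>z. z ^ nat (- n) * g z) \<longlongrightarrow> 0 ^ nat (- n) * g 0) (at 0)"
      by (intro tendsto_intros lim)
    ultimately have "g 1 = 0 ^ nat (- n) * g 0" using tendsto_unique[OF at_neq_bot] by blast
    then show ?thesis using that by (simp add: power_0_left)
  qed
  have zero: "g 0 = 0" if "n \<noteq> 0"
    using that g0 v b by (auto simp: part_def n)
  have "g z = (if n < 0 then 0 else z ^ nat n * g 1)"
  proof (cases "z = 0")
    case True
    then show ?thesis using 0 zero g0 by (auto simp: power_0_left g_def)
  next
    case False
    then show ?thesis using power[OF False] neg by (auto simp: power_int_def)
  qed
  then show "crd (rho (M z) v) b = (if n < 0 then 0 else z ^ nat n * crd (rho (M 1) v) b)"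
    by (simp add: g_def)
qed

lemma isCont_unipotent:
  "isCont (\<lambda>z. upper_unipotent z $ i $ j) a" "isCont (\<lambda>z. lower_unipotent z $ i $ j) a"
  using exhaust_2[of i] exhaust_2[of j] by auto

lemma upper_coordinates:
  assumes "b \<in> Basis" "v \<in> part j"
  shows "crd (rho (upper_unipotent z) v) b =
    (if deg b - j < 0 then 0 else z ^ nat (deg b - j) * crd (rho (upper_unipotent 1) v) b)"
  by (rule unipotent_coordinates(1)[where e = 1])
    (use assms torus_conj_upper isCont_unipotent in \<open>auto simp: unipotent_zero\<close>)

lemma lower_coordinate_same:
  assumes "b \<in> Basis" "v \<in> part (deg b)"
  shows "crd (rho (lower_unipotent 1) v) b = crd v b"
  by (rule unipotent_coordinates(2)[where e = "-1" and n = 0 and j = "deg b" and M = lower_unipotent])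
    (use assms torus_conj_lower isCont_unipotent in \<open>auto simp: unipotent_zero power_int_minus\<close>)

definition raising :: "int \<Rightarrow> 'g \<Rightarrow> 'g" where
  "raising j v = proj (j + 1) (rho (upper_unipotent 1) v)"

definition lowering :: "int \<Rightarrow> 'g \<Rightarrow> 'g" where
  "lowering j v = proj (j - 1) (rho (lower_unipotent 1) v)"

lemma linear_raising: "Vector_Spaces.linear scale scale (raising j)"
  using Vector_Spaces.linear_compose[OF linear_rho linear_proj]
  by (auto simp: raising_def[abs_def] comp_def)

lemma linear_lowering: "Vector_Spaces.linear scale scale (lowering j)"
  using Vector_Spaces.linear_compose[OF linear_rho linear_proj]
  by (auto simp: lowering_def[abs_def] comp_def)

text \<open>
  Apply \<open>unipotent_exchange\<close> to a vector \<open>v\<close> of degree \<open>j\<close> and compare the components in degree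
  \<open>j\<close>.  With \<open>z = x\<^sup>2 - 1\<close> the torus factors contribute \<open>(1 + z)\<^sup>2\<^sup>j\<^sup>-\<^sup>1\<close> on the right; apart from
  this factor both sides are polynomials in \<open>z\<close> with constant term \<open>v\<close> and with the linear coefficients
  \<open>ef v\<close> and \<open>fe v\<close>.  Equality of the derivatives at \<open>z = 0\<close> is the claim.
\<close>
lemma commutation_relation:
  assumes v: "v \<in> part j"
  shows "raising (j - 1) (lowering j v) = of_int (2 * j - 1) \<odot> v + lowering (j + 1) (raising j v)"
proof (rule crd_eqI)
  fix b assume b: "b \<in> Basis"
  let ?U = upper_unipotent and ?L = "lower_unipotent 1" and ?J = "deg ` Basis"
  show "crd (raising (j - 1) (lowering j v)) b
      = crd (of_int (2 * j - 1) \<odot> v + lowering (j + 1) (raising j v)) b"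
  proof (cases "deg b = j")
    case False
    then show ?thesis using b v by (simp add: raising_def lowering_def crd_proj part_def)
  next
    case deg: True
    define y where "y = rho ?L v"
    define A where "A k = crd (rho (?U 1) (proj k y)) b" for k
    define B where "B k = crd (rho ?L (proj k (rho (?U 1) v))) b" for k
    have A_outside: "A k = 0" and B_outside: "B k = 0" if "k \<notin> ?J" for k
      unfolding A_def B_def proj_outside[OF that]
      by (simp_all add: linear_zero[OF linear_rho])
    have left: "crd (rho (?U z) y) b = (\<Sum>k\<in>?J. (if j - k < 0 then 0 else z ^ nat (j - k)) * A k)" for z
    proof -
      have "crd (rho (?U z) y) b = (\<Sum>k\<in>?J. crd (rho (?U z) (proj k y)) b)"
        by (subst sum_proj[symmetric, of y]) (simp add: rho_sum crd_sum)
      also have "\<dots> = (\<Sum>k\<in>?J. (if j - k < 0 then 0 else z ^ nat (j - k)) * A k)"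
        by (rule sum.cong[OF refl], subst upper_coordinates[OF b proj_in_part])
          (simp add: deg A_def)
      finally show ?thesis .
    qed
    have proj_U: "proj k (rho (?U z) v)
        = (if k - j < 0 then 0 else z ^ nat (k - j)) \<odot> proj k (rho (?U 1) v)" for k z
    proof (rule crd_eqI)
      fix c assume c: "c \<in> Basis"
      show "crd (proj k (rho (?U z) v)) c
          = crd ((if k - j < 0 then 0 else z ^ nat (k - j)) \<odot> proj k (rho (?U 1) v)) c"
        using upper_coordinates[OF c v, of z] c by (simp add: crd_proj)
    qed
    have right: "crd (rho ?L (rho (?U z) v)) b
        = (\<Sum>k\<in>?J. (if k - j < 0 then 0 else z ^ nat (k - j)) * B k)" for z
    proof -
      have "crd (rho ?L (rho (?U z) v)) b = (\<Sum>k\<in>?J. crd (rho ?L (proj k (rho (?U z) v))) b)"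
        by (subst sum_proj[symmetric, of "rho (?U z) v"]) (simp add: rho_sum crd_sum)
      also have "\<dots> = (\<Sum>k\<in>?J. (if k - j < 0 then 0 else z ^ nat (k - j)) * B k)"
        by (rule sum.cong[OF refl], subst proj_U) (simp add: rho_scale B_def)
      finally show ?thesis .
    qed
    \<comment> \<open>Every \<open>1 + z \<noteq> 0\<close> has a square root, so the identity in \<open>x\<close> is one in \<open>z\<close>.\<close>
    have exchange: "crd (rho (?U z) y) b = (1 + z) powi (2 * j - 1) * crd (rho ?L (rho (?U z) v)) b"
      if "z \<noteq> -1" for z
    proof -
      define x where "x = csqrt (1 + z)"
      have x: "x \<noteq> 0" "x\<^sup>2 = 1 + z" "z = x\<^sup>2 - 1"
        using that by (auto simp: x_def add_eq_0_iff)
      have "rho (?U z) y = rho (?U z ** ?L) v" by (simp add: rho_mult y_def)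
      also have "\<dots> = torus x (rho ?L (rho (?U z) (torus x v)))"
        unfolding x(3) unipotent_exchange[OF x(1)]
        using x(1) by (simp add: rho_mult det_mul rho_torus)
      finally have "crd (rho (?U z) y) b
          = x powi (2 * j - 1) * (x powi (2 * j - 1) * crd (rho ?L (rho (?U z) v)) b)"
        using x(1) by (simp add: crd_torus b deg torus_part[OF v] rho_scale)
      also have "\<dots> = (x\<^sup>2) powi (2 * j - 1) * crd (rho ?L (rho (?U z) v)) b"
        by (simp add: power2_eq_square power_int_mult_distrib)
      finally show ?thesis by (simp only: x(2))
    qed
    have dleft: "((\<lambda>z. crd (rho (?U z) y) b) has_field_derivative A (j - 1)) (at 0)"
    proof -
      have "((\<lambda>z. crd (rho (?U z) y) b) has_field_derivative
          (\<Sum>k\<in>?J. if j - k = 1 then A k else 0)) (at 0)"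
        unfolding left by (rule DERIV_sum, rule has_derivative_at_0_truncated_power)
      also have "(\<Sum>k\<in>?J. if j - k = 1 then A k else 0) = (\<Sum>k\<in>?J. if k = j - 1 then A k else 0)"
        by (rule sum.cong) auto
      also have "\<dots> = A (j - 1)"
        using A_outside[of "j - 1"] by (simp add: finite_Basis)
      finally show ?thesis .
    qed
    have dright: "((\<lambda>z. crd (rho ?L (rho (?U z) v)) b) has_field_derivative B (j + 1)) (at 0)"
    proof -
      have "((\<lambda>z. crd (rho ?L (rho (?U z) v)) b) has_field_derivative
          (\<Sum>k\<in>?J. if k - j = 1 then B k else 0)) (at 0)"
        unfolding right by (rule DERIV_sum, rule has_derivative_at_0_truncated_power)
      also have "(\<Sum>k\<in>?J. if k - j = 1 then B k else 0) = (\<Sum>k\<in>?J. if k = j + 1 then B k else 0)"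
        by (rule sum.cong) auto
      also have "\<dots> = B (j + 1)"
        using B_outside[of "j + 1"] by (simp add: finite_Basis)
      finally show ?thesis .
    qed
    have value0: "crd (rho ?L (rho (?U 0) v)) b = crd v b"
      using lower_coordinate_same[OF b] v deg by (simp add: unipotent_zero rho_one)
    have dprod: "((\<lambda>z. (1 + z) powi (2 * j - 1) * crd (rho ?L (rho (?U z) v)) b)
        has_field_derivative of_int (2 * j - 1) * crd v b + B (j + 1)) (at 0)"
      by (rule derivative_eq_intros dright refl | simp add: value0)+
    have ev: "\<forall>\<^sub>F z in nhds 0. crd (rho (?U z) y) b
        = (1 + z) powi (2 * j - 1) * crd (rho ?L (rho (?U z) v)) b"
    proof -
      have "\<forall>\<^sub>F z in nhds (0::complex). z \<noteq> -1"
        by (rule t1_space_nhds) simp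
      then show ?thesis by eventually_elim (rule exchange)
    qed
    have "A (j - 1) = of_int (2 * j - 1) * crd v b + B (j + 1)"
      using dleft dprod DERIV_cong_ev[OF refl ev refl] DERIV_unique by blast
    then show ?thesis
      using b deg by (simp add: raising_def lowering_def crd_proj A_def B_def y_def)
  qed
qed

text \<open>
  If \<open>f v = 0\<close>, then \<open>f e\<^sup>k\<^sup>+\<^sup>1 v\<close> is a negative multiple of \<open>e\<^sup>k v\<close>, as all the weights that are
  added up are positive.  So no \<open>e\<^sup>k v\<close> vanishes unless \<open>v\<close> does, against the finiteness of the
  grading.
\<close>
lemma lowering_injective:
  assumes j: "j \<ge> 1" and v: "v \<in> part j" and low: "lowering j v = 0"
  shows "v = 0"
proof (rule ccontr)
  assume v0: "v \<noteq> 0"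
  define w where "w = rec_nat v (\<lambda>k. raising (j + int k))"
  have w0: "w 0 = v" and wS: "w (Suc k) = raising (j + int k) (w k)" for k
    by (simp_all add: w_def)
  have wpart: "w k \<in> part (j + int k)" for k
  proof (induction k)
    case (Suc k)
    show ?case using proj_in_part[of "j + int k + 1"] by (simp add: wS raising_def ac_simps)
  qed (simp add: w0 v)
  have step: "\<exists>c>0. lowering (j + int (Suc k)) (w (Suc k)) = complex_of_int (- c) \<odot> w k" for k
  proof (induction k)
    case 0
    have "lowering (j + 1) (raising j v) = complex_of_int (- (2 * j - 1)) \<odot> v"
      using commutation_relation[OF v] low linear_zero[OF linear_raising]
      by (simp only: of_int_minus scale_minus_left) (metis add_eq_0_iff)
    then show ?case using j by (intro exI[of _ "2 * j - 1"]) (simp add: wS w0)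
  next
    case (Suc k)
    then obtain c where c: "c > 0" "lowering (j + int (Suc k)) (w (Suc k)) = complex_of_int (- c) \<odot> w k"
      by blast
    define i where "i = j + int (Suc k)"
    have "raising (i - 1) (lowering i (w (Suc k))) = complex_of_int (- c) \<odot> w (Suc k)"
    proof -
      have lin: "raising (j + int k) (a \<odot> x) = a \<odot> raising (j + int k) x" for a x
        using linear_raising by (simp add: Vector_Spaces.linear_iff)
      have "i - 1 = j + int k" by (simp add: i_def)
      then show ?thesis using c(2)[folded i_def] lin wS[of k] by metis
    qed
    then have "lowering (i + 1) (raising i (w (Suc k)))
        = complex_of_int (- c) \<odot> w (Suc k) - complex_of_int (2 * i - 1) \<odot> w (Suc k)"
      using commutation_relation[OF wpart[of "Suc k"], folded i_def] by (metis add_diff_cancel_left')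
    also have "\<dots> = complex_of_int (- (c + (2 * i - 1))) \<odot> w (Suc k)"
      by (simp only: scale_left_diff_distrib[symmetric]) simp
    finally have "lowering (i + 1) (raising i (w (Suc k)))
        = complex_of_int (- (c + (2 * i - 1))) \<odot> w (Suc k)" .
    moreover have "c + (2 * i - 1) > 0" using c(1) j by (simp add: i_def)
    moreover have "j + int (Suc (Suc k)) = i + 1" by (simp add: i_def)
    ultimately show ?case
      unfolding wS[of "Suc k"] i_def[symmetric] by metis
  qed
  have nz: "w k \<noteq> 0" for k
  proof (induction k)
    case (Suc k)
    show ?case
    proof
      assume "w (Suc k) = 0"
      moreover obtain c where "c > 0" "lowering (j + int (Suc k)) (w (Suc k)) = complex_of_int (- c) \<odot> w k"
        using step by blast
      ultimately show False using Suc linear_zero[OF linear_lowering] by simp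
    qed
  qed (simp add: w0 v0)
  have "range (\<lambda>k. j + int k) \<subseteq> {i. mult i \<noteq> 0}"
    using part_trivial[OF _ wpart] nz by auto
  then have "finite (range (\<lambda>k. j + int k))" using finite_mult_support finite_subset by blast
  then show False by (simp add: finite_image_iff inj_on_def)
qed

lemma mult_decreasing:
  assumes "m \<ge> 1"
  shows "mult (m + 1) \<le> mult m"
proof -
  interpret L: Vector_Spaces.linear scale scale "lowering (m + 1)" by (rule linear_lowering)
  have inj: "inj_on (lowering (m + 1)) (part (m + 1))"
    using lowering_injective[of "m + 1"] assms
    by (subst L.inj_on_iff_eq_0[OF subspace_part]) auto
  interpret P: finite_dimensional_vector_space_pair_1 scale Basis scale by unfold_locales
  have "mult (m + 1) = dim (lowering (m + 1) ` part (m + 1))"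
    using P.dim_image_eq[OF linear_lowering, of "m + 1" "part (m + 1)"] inj
    by (simp add: dim_part span_eq_iff[THEN iffD2, OF subspace_part])
  also have "\<dots> \<le> dim (part m)"
    by (rule dim_subset) (auto simp: lowering_def intro: proj_in_part[of m, simplified])
  finally show ?thesis by (simp add: dim_part)
qed

end

section \<open>Symmetric powers\<close>

lemma matrix_polynomial_sum:
  assumes "\<And>s. s \<in> S \<Longrightarrow> matrix_polynomial (f s)"
  shows "matrix_polynomial (\<lambda>A. \<Sum>s\<in>S. f s A)"
  using assms
  by (induction S rule: infinite_finite_induct) (auto intro: matrix_polynomial.intros)

definition binary_form_expansion ::
  "nat \<Rightarrow> (complex^2^2 \<Rightarrow> complex^2 \<Rightarrow> complex) \<Rightarrow> (nat \<Rightarrow> complex^2^2 \<Rightarrow> complex) \<Rightarrow> bool" where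
  "binary_form_expansion n P M \<longleftrightarrow> (\<forall>k. matrix_polynomial (M k)) \<and>
     (\<forall>A p. P A p = (\<Sum>k\<le>n. M k A * (p $ 1 ^ (n - k) * p $ 2 ^ k)))"

lemma binary_form_expansion_mult_linear:
  assumes "binary_form_expansion n P M"
  shows "\<exists>M'. binary_form_expansion (Suc n) (\<lambda>A p. (A *v p) $ i * P A p) M'"
proof -
  define M' where "M' k A = A $ i $ 1 * (if k \<le> n then M k A else 0)
      + A $ i $ 2 * (if k = 0 then 0 else M (k - 1) A)" for k A
  have M: "matrix_polynomial (M k)" for k
    using assms by (simp add: binary_form_expansion_def)
  have poly: "matrix_polynomial (M' k)" for k
    unfolding M'_def
    by (cases "k \<le> n"; cases "k = 0") (auto intro!: matrix_polynomial.intros M)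
  have "(A *v p) $ i * P A p = (\<Sum>k\<le>Suc n. M' k A * (p $ 1 ^ (Suc n - k) * p $ 2 ^ k))" for A p
  proof -
    have "(\<Sum>k\<le>Suc n. M' k A * (p $ 1 ^ (Suc n - k) * p $ 2 ^ k))
      = (\<Sum>k\<le>Suc n. A $ i $ 1 * (if k \<le> n then M k A else 0) * (p $ 1 ^ (Suc n - k) * p $ 2 ^ k))
      + (\<Sum>k\<le>Suc n. A $ i $ 2 * (if k = 0 then 0 else M (k - 1) A) * (p $ 1 ^ (Suc n - k) * p $ 2 ^ k))"
      by (simp only: M'_def distrib_right sum.distrib)
    also have "(\<Sum>k\<le>Suc n. A $ i $ 1 * (if k \<le> n then M k A else 0) * (p $ 1 ^ (Suc n - k) * p $ 2 ^ k))
      = (\<Sum>k\<le>n. A $ i $ 1 * p $ 1 * (M k A * (p $ 1 ^ (n - k) * p $ 2 ^ k)))"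
      by (simp add: Suc_diff_le mult_ac)
    also have "(\<Sum>k\<le>Suc n. A $ i $ 2 * (if k = 0 then 0 else M (k - 1) A) * (p $ 1 ^ (Suc n - k) * p $ 2 ^ k))
      = (\<Sum>k\<le>n. A $ i $ 2 * p $ 2 * (M k A * (p $ 1 ^ (n - k) * p $ 2 ^ k)))"
      by (subst sum.atMost_Suc_shift) (simp add: mult_ac)
    also have "(\<Sum>k\<le>n. A $ i $ 1 * p $ 1 * (M k A * (p $ 1 ^ (n - k) * p $ 2 ^ k)))
      = A $ i $ 1 * p $ 1 * P A p"
      using assms by (simp only: sum_distrib_left[symmetric] binary_form_expansion_def)
    also have "(\<Sum>k\<le>n. A $ i $ 2 * p $ 2 * (M k A * (p $ 1 ^ (n - k) * p $ 2 ^ k)))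
      = A $ i $ 2 * p $ 2 * P A p"
      using assms by (simp only: sum_distrib_left[symmetric] binary_form_expansion_def)
    finally show ?thesis
      by (simp add: matrix_vector_mult_def sum_2 algebra_simps)
  qed
  then show ?thesis using poly unfolding binary_form_expansion_def by blast
qed

lemma exists_binary_form_expansion:
  "\<exists>M. binary_form_expansion (a + b) (\<lambda>A p. (A *v p) $ 1 ^ a * (A *v p) $ 2 ^ b) M"
proof (induction a)
  case 0
  show ?case
  proof (induction b)
    case 0
    show ?case
      by (intro exI[of _ "\<lambda>k A. 1"]) (simp add: binary_form_expansion_def matrix_polynomial.intros)
  next
    case (Suc b)
    then show ?case using binary_form_expansion_mult_linear[where i = 2] by fastforce
  qed
next
  case (Suc a)
  then obtain M where "binary_form_expansion (a + b) (\<lambda>A p. (A *v p) $ 1 ^ a * (A *v p) $ 2 ^ b) M"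
    by blast
  from binary_form_expansion_mult_linear[OF this, of 1] show ?case by (simp add: mult.assoc)
qed

text \<open>
  Row \<open>l\<close> of the matrix of \<open>Sym\<^sup>n(A)\<close> in the monomial coordinates of the rational normal curve.  It is
  characterised by the substitution rule \<open>sym_power_entry\<close>, which an explicit sum of products of binomial
  coefficients would hide.
\<close>
definition sym_power_entry :: "nat \<Rightarrow> nat \<Rightarrow> nat \<Rightarrow> complex^2^2 \<Rightarrow> complex" where
  "sym_power_entry n l = (SOME M. binary_form_expansion n
     (\<lambda>A p. (A *v p) $ 1 ^ (n - l) * (A *v p) $ 2 ^ l) M)"

lemma sym_power_entry:
  assumes "l \<le> n"
  shows "matrix_polynomial (sym_power_entry n l k)"
    and "(A *v p) $ 1 ^ (n - l) * (A *v p) $ 2 ^ l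
      = (\<Sum>k\<le>n. sym_power_entry n l k A * (p $ 1 ^ (n - k) * p $ 2 ^ k))"
proof -
  have "\<exists>M. binary_form_expansion n (\<lambda>A p. (A *v p) $ 1 ^ (n - l) * (A *v p) $ 2 ^ l) M"
    using exists_binary_form_expansion[of "n - l" l] assms by simp
  then have *: "binary_form_expansion n (\<lambda>A p. (A *v p) $ 1 ^ (n - l) * (A *v p) $ 2 ^ l)
      (sym_power_entry n l)"
    unfolding sym_power_entry_def by (rule someI_ex)
  show "matrix_polynomial (sym_power_entry n l k)"
    using * unfolding binary_form_expansion_def by blast
  show "(A *v p) $ 1 ^ (n - l) * (A *v p) $ 2 ^ l
      = (\<Sum>k\<le>n. sym_power_entry n l k A * (p $ 1 ^ (n - k) * p $ 2 ^ k))"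
    using * unfolding binary_form_expansion_def by blast
qed

text \<open>
  The string \<open>d i 0, \<dots>, d i (n i)\<close> has the weights of \<open>Sym\<^sup>n(\<complex>\<^sup>2)\<close> for \<open>n = n i\<close>.  The binomial
  coefficients in the pairing are the ones for which the invariant form becomes a power of the
  determinant on the curve \<open>veronese i\<close>; the vectors correspond to \<open>(n choose k) X\<^sup>n\<^sup>-\<^sup>k Y\<^sup>k\<close>.
\<close>
locale string_decomposition = graded_symplectic scale Basis deg om
  for scale :: "complex \<Rightarrow> 'g::ab_group_add \<Rightarrow> 'g" (infixr "\<odot>" 75) and Basis :: "'g set"
    and deg :: "'g \<Rightarrow> int" and om :: "'g \<Rightarrow> 'g \<Rightarrow> complex" +
  fixes I :: "'i set" and n :: "'i \<Rightarrow> nat" and d :: "'i \<Rightarrow> nat \<Rightarrow> 'g"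
  assumes finite_I: "finite I"
    and torus_d: "i \<in> I \<Longrightarrow> k \<le> n i \<Longrightarrow> x \<noteq> 0 \<Longrightarrow>
      torus x (d i k) = x powi (int (n i) - 2 * int k) \<odot> d i k"
    and om_d: "i \<in> I \<Longrightarrow> i' \<in> I \<Longrightarrow> k \<le> n i \<Longrightarrow> l \<le> n i' \<Longrightarrow>
      om (d i k) (d i' l) = (if i = i' \<and> k + l = n i then (-1) ^ k * of_nat (n i choose k) else 0)"
    and span_d: "span {d i k | i k. i \<in> I \<and> k \<le> n i} = UNIV"
begin

definition veronese :: "'i \<Rightarrow> complex^2 \<Rightarrow> 'g" where
  "veronese i p = (\<Sum>k\<le>n i. (p $ 1 ^ (n i - k) * p $ 2 ^ k) \<odot> d i k)"

definition coord :: "'i \<Rightarrow> nat \<Rightarrow> 'g \<Rightarrow> complex" where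
  "coord i k v = om (d i (n i - k)) v / om (d i (n i - k)) (d i k)"

definition sym_action :: "complex^2^2 \<Rightarrow> 'g \<Rightarrow> 'g" where
  "sym_action A v = (\<Sum>i\<in>I. \<Sum>l\<le>n i. (\<Sum>k\<le>n i. sym_power_entry (n i) l k A * coord i k v) \<odot> d i l)"

text \<open>
  The sum is the binomial expansion of the power of the determinant.
\<close>
lemma om_veronese:
  assumes "i \<in> I" "i' \<in> I"
  shows "om (veronese i p) (veronese i' q)
    = (if i = i' then (p $ 1 * q $ 2 - p $ 2 * q $ 1) ^ n i else 0)"
proof -
  let ?c = "\<lambda>k l. p $ 1 ^ (n i - k) * p $ 2 ^ k * (q $ 1 ^ (n i' - l) * q $ 2 ^ l)"
  have "om (veronese i p) (veronese i' q)
      = (\<Sum>k\<le>n i. \<Sum>l\<le>n i'. ?c k l * om (d i k) (d i' l))"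
    unfolding veronese_def by (simp only: om_sum_left) (simp add: om_sum_right sum_distrib_left mult_ac)
  also have "\<dots> = (if i = i' then (p $ 1 * q $ 2 - p $ 2 * q $ 1) ^ n i else 0)"
  proof (cases "i = i'")
    case False
    then show ?thesis using assms by (simp add: om_d)
  next
    case True
    have "(\<Sum>l\<le>n i'. ?c k l * om (d i k) (d i' l))
        = of_nat (n i choose k) * (- (p $ 2 * q $ 1)) ^ k * (p $ 1 * q $ 2) ^ (n i - k)"
      if k: "k \<le> n i" for k
    proof -
      have "(\<Sum>l\<le>n i'. ?c k l * om (d i k) (d i' l))
          = (\<Sum>l\<le>n i. if l = n i - k then ?c k l * ((-1) ^ k * of_nat (n i choose k)) else 0)"
        using True assms k by (intro sum.cong) (auto simp: om_d)
      also have "\<dots> = ?c k (n i - k) * ((-1) ^ k * of_nat (n i choose k))"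
        by (simp add: sum.delta)
      also have "\<dots> = of_nat (n i choose k) * (- (p $ 2 * q $ 1)) ^ k * (p $ 1 * q $ 2) ^ (n i - k)"
        using True k by (simp add: power_mult_distrib power_minus[of "p $ 2 * q $ 1"])
      finally show ?thesis .
    qed
    then show ?thesis
      using True binomial_ring[of "- (p $ 2 * q $ 1)" "p $ 1 * q $ 2" "n i"] by simp
  qed
  finally show ?thesis .
qed

text \<open>
  On \<open>p = (1, t)\<close> the functional is a polynomial in \<open>t\<close> whose coefficients are its values on the
  string.  So the points of the curves span the space, and linear statements about the action need
  only be checked on them.
\<close>
lemma functional_eq_0_if_veronese:
  assumes f: "Vector_Spaces.linear scale (*) f"
    and 0: "\<And>i p. i \<in> I \<Longrightarrow> f (veronese i p) = 0"
  shows "f v = 0"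
proof -
  interpret f: Vector_Spaces.linear scale "(*)" f by (rule f)
  have "f (d i k) = 0" if i: "i \<in> I" and k: "k \<le> n i" for i k
  proof -
    have "(\<Sum>k\<le>n i. f (d i k) * t ^ k) = 0" for t
      using 0[OF i, of "vector [1, t]"] by (simp add: veronese_def f.sum f.scale mult.commute)
    then show ?thesis using polyfun_eq_0[of "\<lambda>k. f (d i k)" "n i"] k by simp
  qed
  then have "span {d i k | i k. i \<in> I \<and> k \<le> n i} \<subseteq> {v. f v = 0}"
    by (intro span_minimal) (auto simp: subspace_def f.add f.scale)
  then show ?thesis by (auto simp: span_d)
qed

lemma linear_eq_if_veronese:
  assumes "Vector_Spaces.linear scale scale L" "Vector_Spaces.linear scale scale L'"
    and eq: "\<And>i p. i \<in> I \<Longrightarrow> L (veronese i p) = L' (veronese i p)"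
  shows "L v = L' v"
proof (rule crd_eqI)
  fix b
  have "Vector_Spaces.linear scale (*) (\<lambda>v. crd (L v) b - crd (L' v) b)"
    using assms(1,2) by (intro linear_functionalI) (auto simp: Vector_Spaces.linear_iff algebra_simps)
  from functional_eq_0_if_veronese[OF this, of v] show "crd (L v) b = crd (L' v) b"
    by (simp add: eq)
qed

lemma coord_d:
  assumes "i \<in> I" "i' \<in> I" "k \<le> n i" "l \<le> n i'"
  shows "coord i k (d i' l) = (if i = i' \<and> k = l then 1 else 0)"
  using assms by (auto simp: coord_def om_d)

lemma linear_coord: "Vector_Spaces.linear scale (*) (coord i k)"
  by (rule linear_functionalI) (auto simp: coord_def add_divide_distrib)

lemma coord_veronese:
  assumes "i \<in> I" "i' \<in> I" "k \<le> n i"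
  shows "coord i k (veronese i' p) = (if i = i' then p $ 1 ^ (n i - k) * p $ 2 ^ k else 0)"
proof -
  interpret c: Vector_Spaces.linear scale "(*)" "coord i k" by (rule linear_coord)
  have "coord i k (veronese i' p)
      = (\<Sum>l\<le>n i'. if k = l then (if i = i' then p $ 1 ^ (n i - k) * p $ 2 ^ k else 0) else 0)"
    unfolding veronese_def c.sum c.scale by (rule sum.cong) (use assms in \<open>auto simp: coord_d\<close>)
  then show ?thesis using assms(3) by auto
qed

lemma linear_sym_action: "Vector_Spaces.linear scale scale (sym_action A)"
proof -
  have c: "coord i k (v + w) = coord i k v + coord i k w" "coord i k (a \<odot> v) = a * coord i k v"
    for i k v w a
    using linear_coord by (auto simp: Vector_Spaces.linear_iff)
  show ?thesis
    by (rule linear_endoI)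
      (simp_all add: sym_action_def c distrib_left scale_left_distrib sum.distrib scale_sum_right
        sum_distrib_left mult_ac)
qed

lemma sym_action_veronese:
  assumes i: "i \<in> I"
  shows "sym_action A (veronese i p) = veronese i (A *v p)"
proof -
  have "sym_action A (veronese i p) = (\<Sum>i'\<in>I. if i' = i then
      (\<Sum>l\<le>n i. (\<Sum>k\<le>n i. sym_power_entry (n i) l k A * (p $ 1 ^ (n i - k) * p $ 2 ^ k)) \<odot> d i l) else 0)"
    unfolding sym_action_def by (rule sum.cong) (use i in \<open>auto simp: coord_veronese\<close>)
  also have "\<dots> = (\<Sum>l\<le>n i. (\<Sum>k\<le>n i. sym_power_entry (n i) l k A * (p $ 1 ^ (n i - k) * p $ 2 ^ k)) \<odot> d i l)"
    using i finite_I by simp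
  also have "\<dots> = veronese i (A *v p)"
    unfolding veronese_def by (rule sum.cong) (auto simp: sym_power_entry(2)[symmetric])
  finally show ?thesis .
qed

lemma sym_action_mult: "sym_action (A ** C) v = sym_action A (sym_action C v)"
  using linear_eq_if_veronese[OF linear_sym_action
      Vector_Spaces.linear_compose[OF linear_sym_action linear_sym_action], of "A ** C" A C]
  by (simp add: sym_action_veronese matrix_vector_mul_assoc)

text \<open>
  Both sides are bilinear, so \<open>functional_eq_0_if_veronese\<close> reduces the claim, one argument at a time,
  to the curves, where it is the multiplicativity of the determinant.
\<close>
lemma om_sym_action:
  assumes det: "det A = 1"
  shows "om (sym_action A v) (sym_action A w) = om v w"
proof -
  have add: "sym_action A (v + w) = sym_action A v + sym_action A w"
    and scale: "sym_action A (a \<odot> v) = a \<odot> sym_action A v" for v w a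
    using linear_sym_action by (auto simp: Vector_Spaces.linear_iff)
  have ver: "om (sym_action A (veronese i p)) (sym_action A (veronese i' q))
      = om (veronese i p) (veronese i' q)" if "i \<in> I" "i' \<in> I" for i i' p q
  proof -
    have "(A *v p) $ 1 * (A *v q) $ 2 - (A *v p) $ 2 * (A *v q) $ 1
        = det A * (p $ 1 * q $ 2 - p $ 2 * q $ 1)"
      by (simp add: matrix_vector_mult_def sum_2 det_2 algebra_simps)
    then show ?thesis using that by (simp add: sym_action_veronese om_veronese det)
  qed
  have half: "om (sym_action A v) (sym_action A (veronese i' q)) = om v (veronese i' q)"
    if "i' \<in> I" for i' q v
  proof -
    let ?f = "\<lambda>v. om (sym_action A v) (sym_action A (veronese i' q)) - om v (veronese i' q)"
    have "Vector_Spaces.linear scale (*) ?f"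
      by (rule linear_functionalI) (auto simp: add scale algebra_simps)
    from functional_eq_0_if_veronese[OF this, of v] show ?thesis by (simp add: ver that)
  qed
  let ?g = "\<lambda>w. om (sym_action A v) (sym_action A w) - om v w"
  have "Vector_Spaces.linear scale (*) ?g"
    by (rule linear_functionalI) (auto simp: add scale algebra_simps)
  from functional_eq_0_if_veronese[OF this, of w] show ?thesis by (simp add: half)
qed

lemma sym_action_algebraic: "algebraic_SL2_hom scale om sym_action"
proof -
  have "sym_action \<in> hom SL2 (symplectic_group scale om)"
  proof (rule homI)
    fix A :: "complex^2^2" assume "A \<in> carrier SL2"
    then show "sym_action A \<in> carrier (symplectic_group scale om)"
      by (intro in_symplectic_groupI linear_sym_action om_sym_action) (simp add: SL2_def)
  next
    fix A C :: "complex^2^2"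
    show "sym_action (A \<otimes>\<^bsub>SL2\<^esub> C) = sym_action A \<otimes>\<^bsub>symplectic_group scale om\<^esub> sym_action C"
      by (auto simp: SL2_def symplectic_group_def sym_action_mult)
  qed
  moreover have "\<exists>p. matrix_polynomial p \<and> (\<forall>A\<in>carrier SL2. f (sym_action A v) = p A)"
    if f: "Vector_Spaces.linear scale (*) f" for f v
  proof -
    interpret f: Vector_Spaces.linear scale "(*)" f by (rule f)
    have "f (sym_action A v) = (\<Sum>i\<in>I. \<Sum>l\<le>n i.
        (\<Sum>k\<le>n i. sym_power_entry (n i) l k A * coord i k v) * f (d i l))" for A
      by (simp add: sym_action_def f.sum f.scale)
    moreover have "matrix_polynomial (\<lambda>A. \<Sum>i\<in>I. \<Sum>l\<le>n i.
        (\<Sum>k\<le>n i. sym_power_entry (n i) l k A * coord i k v) * f (d i l))"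
      by (rule matrix_polynomial_sum | rule matrix_polynomial.intros(4)
          | rule sym_power_entry(1), simp | rule matrix_polynomial.intros(1))+
    ultimately show ?thesis by (intro exI conjI ballI)
  qed
  ultimately show ?thesis by (simp add: algebraic_SL2_hom_def)
qed

lemma sym_action_torus:
  assumes x: "x \<noteq> 0"
  shows "sym_action (diag_torus x) = torus x"
proof
  fix v
  show "sym_action (diag_torus x) v = torus x v"
  proof (rule linear_eq_if_veronese[OF linear_sym_action linear_torus])
    fix i p assume i: "i \<in> I"
    interpret t: Vector_Spaces.linear scale scale "torus x" by (rule linear_torus)
    have weight: "x ^ (n i - k) * inverse x ^ k = x powi (int (n i) - 2 * int k)" if k: "k \<le> n i" for k
    proof -
      have "x powi (int (n i) - 2 * int k) = x powi (int (n i - k) + - int k)"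
        using k by (simp add: of_nat_diff)
      also have "\<dots> = x ^ (n i - k) * inverse x ^ k"
        using x by (subst power_int_add) (simp_all add: power_int_minus power_inverse)
      finally show ?thesis by simp
    qed
    have "sym_action (diag_torus x) (veronese i p)
        = (\<Sum>k\<le>n i. ((x * p $ 1) ^ (n i - k) * (inverse x * p $ 2) ^ k) \<odot> d i k)"
      unfolding sym_action_veronese[OF i] by (simp add: veronese_def matrix_vector_mult_def sum_2)
    also have "\<dots> = (\<Sum>k\<le>n i. (p $ 1 ^ (n i - k) * p $ 2 ^ k) \<odot> torus x (d i k))"
      by (rule sum.cong) (use i x weight in \<open>auto simp: torus_d power_mult_distrib mult_ac\<close>)
    also have "\<dots> = torus x (veronese i p)" by (simp add: veronese_def t.sum t.scale)
    finally show "sym_action (diag_torus x) (veronese i p) = torus x (veronese i p)" .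
  qed
qed

end

section \<open>String decompositions and the equivalence\<close>

context graded_symplectic
begin

lemma mult_antimono:
  assumes dec: "\<And>m. m \<ge> 1 \<Longrightarrow> mult (m + 1) \<le> mult m" and "1 \<le> j" "j \<le> k"
  shows "mult k \<le> mult j"
  using assms(3)
proof (induction k rule: int_ge_induct)
  case (step k)
  then show ?case using dec[of k] assms(2) by linarith
qed simp

text \<open>
  By unimodality the positive degrees in which an \<open>i\<close>-th basis vector exists form an initial segment.
\<close>
lemma exists_string_length:
  assumes dec: "\<And>m. m \<ge> 1 \<Longrightarrow> mult (m + 1) \<le> mult m"
  shows "\<exists>s::nat. \<forall>j\<ge>1. i < mult j \<longleftrightarrow> j \<le> int s"
proof -
  define S where "S = {j. 1 \<le> j \<and> i < mult j}"
  have fin: "finite S"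
    by (rule finite_subset[OF _ finite_mult_support]) (auto simp: S_def)
  show ?thesis
  proof (cases "S = {}")
    case True
    then show ?thesis by (intro exI[of _ 0]) (auto simp: S_def)
  next
    case False
    define s where "s = nat (Max S)"
    have "Max S \<in> S" using False fin by simp
    then have s: "int s \<in> S" "int s = Max S" by (auto simp: s_def S_def)
    have "i < mult j \<longleftrightarrow> j \<le> int s" if j: "j \<ge> 1" for j
    proof
      assume "i < mult j"
      then show "j \<le> int s" using j fin by (simp add: s S_def)
    next
      assume "j \<le> int s"
      then show "i < mult j" using mult_antimono[OF dec j] s(1) by (fastforce simp: S_def)
    qed
    then show ?thesis by blast
  qed
qed

text \<open>
  String \<open>i\<close> runs through the \<open>i\<close>-th basis vectors in the degrees from \<open>s i\<close> down to \<open>1\<close>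
  and continues with their duals in the degrees \<open>0\<close> down to \<open>1 - s i\<close>; thus position \<open>k\<close> has degree
  \<open>s i - k\<close>.  Only the duals are scaled.  The resulting pairing has the right sign also when the dual
  vector comes first, because \<open>n i = 2 s i - 1\<close> is odd: the form is alternating, and so is the
  invariant form of an odd symmetric power.
\<close>
lemma exists_string_decomposition:
  assumes dec: "\<And>m. m \<ge> 1 \<Longrightarrow> mult (m + 1) \<le> mult m"
  shows "\<exists>I n (d :: nat \<Rightarrow> nat \<Rightarrow> 'g). string_decomposition scale Basis deg om I n d"
proof -
  have "\<exists>e. bij_betw e {0..<mult j} {b\<in>Basis. deg b = j}" for j
    unfolding mult_def by (rule ex_bij_betw_nat_finite) (simp add: finite_Basis)
  then obtain e where e: "\<And>j. bij_betw (e j) {0..<mult j} {b\<in>Basis. deg b = j}" by metis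
  obtain s :: "nat \<Rightarrow> nat" where s: "\<And>i j. j \<ge> 1 \<Longrightarrow> i < mult j \<longleftrightarrow> j \<le> int (s i)"
    using exists_string_length[OF dec] by metis
  define I where "I = {i. i < mult 1}"
  define n where "n i = 2 * s i - 1" for i
  define c where "c i k = ((-1) ^ k * of_nat (n i choose k) :: complex)" for i k
  define d where "d i k = (if k < s i then e (int (s i) - int k) i
      else c i (n i - k) \<odot> dual (e (int (s i) - int (n i - k)) i))" for i k
  have s1: "s i \<ge> 1" if "i \<in> I" for i using that s[of 1 i] by (simp add: I_def)
  have eB: "e j i \<in> Basis" "deg (e j i) = j" if "1 \<le> j" "j \<le> int (s i)" for i j
    using bij_betwE[OF e[of j]] that s[of j i] by auto
  have e_eq: "e j i = e j' i' \<longleftrightarrow> j = j' \<and> i = i'"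
    if "1 \<le> j" "j \<le> int (s i)" "1 \<le> j'" "j' \<le> int (s i')" for i j i' j'
  proof
    assume eq: "e j i = e j' i'"
    then have "j = j'" using eB that by metis
    then show "j = j' \<and> i = i'"
      using eq e[of j] that s[of j i] s[of j i'] by (auto simp: bij_betw_def inj_on_def)
  qed simp
  have e_surj: "\<exists>i. i < mult (deg b) \<and> b = e (deg b) i" if "b \<in> Basis" for b
  proof -
    have "b \<in> e (deg b) ` {0..<mult (deg b)}" using e[of "deg b"] that by (simp add: bij_betw_def)
    then show ?thesis by auto
  qed
  have d_pos: "d i k = e (int (s i) - int k) i" "e (int (s i) - int k) i \<in> Basis"
      "deg (e (int (s i) - int k) i) = int (s i) - int k" if "k < s i" for i k
    using that eB[of "int (s i) - int k" i] by (auto simp: d_def)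
  have d_neg: "d i k = c i (n i - k) \<odot> dual (e (int (s i) - int (n i - k)) i)"
      "e (int (s i) - int (n i - k)) i \<in> Basis"
      "deg (e (int (s i) - int (n i - k)) i) = int (s i) - int (n i - k)"
      "n i - k < s i"
    if "\<not> k < s i" "i \<in> I" for i k
  proof -
    show "n i - k < s i" using that s1[of i] by (simp add: n_def)
    then show "e (int (s i) - int (n i - k)) i \<in> Basis"
        "deg (e (int (s i) - int (n i - k)) i) = int (s i) - int (n i - k)"
      using eB[of "int (s i) - int (n i - k)" i] by auto
  qed (use that in \<open>simp add: d_def\<close>)
  have d_part: "d i k \<in> part (int (s i) - int k)" if "i \<in> I" "k \<le> n i" for i k
  proof (cases "k < s i")
    case True
    then show ?thesis using d_pos[OF True] Basis_in_part by metis
  next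
    case False
    have "dual (e (int (s i) - int (n i - k)) i) \<in> part (1 - (int (s i) - int (n i - k)))"
      using dual_in_part[OF d_neg(2)[OF False that(1)]] d_neg(3)[OF False that(1)] by simp
    moreover have "1 - (int (s i) - int (n i - k)) = int (s i) - int k"
      using that s1[of i] by (simp add: n_def)
    ultimately show ?thesis
      using d_neg(1)[OF False that(1)] subspace_part subspace_scale by metis
  qed
  have om_mixed: "om (d i k) (d i' l) = (if i = i' \<and> k + l = n i then c i k else 0)"
    if i: "i \<in> I" "i' \<in> I" and k: "k < s i" and l: "\<not> l < s i'" "l \<le> n i'" for i i' k l
  proof -
    have "om (d i k) (d i' l) = c i' (n i' - l) *
        crd (e (int (s i) - int k) i) (e (int (s i') - int (n i' - l)) i')"
      unfolding d_pos(1)[OF k] d_neg(1)[OF l(1) i(2)] by (simp add: om_dual)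
    also have "crd (e (int (s i) - int k) i) (e (int (s i') - int (n i' - l)) i')
        = (if i = i' \<and> k = n i' - l then 1 else 0)"
      using e_eq[of "int (s i) - int k" i "int (s i') - int (n i' - l)" i'] k d_neg(4)[OF l(1) i(2)]
      by (auto simp: crd_Basis[OF d_pos(2)[OF k]])
    finally show ?thesis using l(2) by auto
  qed
  have om_d: "om (d i k) (d i' l) = (if i = i' \<and> k + l = n i then c i k else 0)"
    if i: "i \<in> I" "i' \<in> I" and k: "k \<le> n i" and l: "l \<le> n i'" for i i' k l
  proof -
    consider "k < s i" "\<not> l < s i'" | "\<not> k < s i" "l < s i'"
      | "k < s i" "l < s i'" | "\<not> k < s i" "\<not> l < s i'" by blast
    then show ?thesis
    proof cases
      case 1
      then show ?thesis using om_mixed i l by blast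
    next
      case 2
      have "om (d i k) (d i' l) = (if i' = i \<and> l + k = n i' then - c i' l else 0)"
        using om_mixed[OF i(2,1) 2(2,1) k] om_swap[of "d i k" "d i' l"] by simp
      moreover have "- c i l = c i k" if "k + l = n i"
      proof -
        have "odd (n i)" using s1[OF i(1)] by (simp add: n_def)
        then have "(-1 :: complex) ^ k = - ((-1) ^ l)"
          using that by (metis even_add neg_one_even_power neg_one_odd_power minus_minus)
        moreover have "n i choose l = n i choose k"
          using that binomial_symmetric[of k "n i"] by (metis add_diff_cancel_left' le_add1)
        ultimately show ?thesis by (simp add: c_def)
      qed
      ultimately show ?thesis by (auto simp: add.commute)
    next
      case 3
      then have "om (d i k) (d i' l) = 0" and "\<not> (i = i' \<and> k + l = n i)"
        using om_part[OF d_part[OF i(1) k] d_part[OF i(2) l]] by (auto simp: n_def)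
      then show ?thesis by auto
    next
      case 4
      then have "om (d i k) (d i' l) = 0" and "\<not> (i = i' \<and> k + l = n i)"
        using om_part[OF d_part[OF i(1) k] d_part[OF i(2) l]] s1[OF i(1)] by (auto simp: n_def)
      then show ?thesis by auto
    qed
  qed
  have torus_d: "torus x (d i k) = x powi (int (n i) - 2 * int k) \<odot> d i k"
    if "i \<in> I" "k \<le> n i" for i k x
  proof -
    have "2 * (int (s i) - int k) - 1 = int (n i) - 2 * int k" using s1[OF that(1)] by (simp add: n_def)
    then show ?thesis using torus_part[OF d_part[OF that], of x] by (simp only:)
  qed
  define D where "D = {d i k | i k. i \<in> I \<and> k \<le> n i}"
  \<comment> \<open>Every basis vector of positive degree and its dual occur, up to a scalar, in mirror positions.\<close>
  have D_index: "\<exists>i k. i \<in> I \<and> k < s i \<and> k \<le> n i \<and> b = d i k \<and> dual b = (1 / c i k) \<odot> d i (n i - k)"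
    if b: "b \<in> Basis" "deg b \<ge> 1" for b
  proof -
    obtain i where i: "i < mult (deg b)" "b = e (deg b) i" using e_surj[OF b(1)] by blast
    have iI: "i \<in> I" using i(1) mult_antimono[OF dec order_refl b(2)] by (simp add: I_def)
    define k where "k = s i - nat (deg b)"
    have le: "deg b \<le> int (s i)" using s[OF b(2)] i(1) by simp
    then have k: "k < s i" "int (s i) - int k = deg b" "k \<le> n i" "\<not> n i - k < s i" "n i - (n i - k) = k"
      using b(2) by (auto simp: k_def n_def)
    have "b = d i k" using d_pos(1)[OF k(1)] i(2) k(2) by simp
    moreover have "c i k \<noteq> 0" using k(3) by (simp add: c_def)
    then have "dual b = (1 / c i k) \<odot> d i (n i - k)"
      using d_neg(1)[OF k(4) iI] i(2) k(2,5) by simp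
    ultimately show ?thesis using iI k by blast
  qed
  have inD: "d i k \<in> span D" if "i \<in> I" "k \<le> n i" for i k
    by (rule span_base) (use that in \<open>auto simp: D_def\<close>)
  have "Basis \<subseteq> span D"
  proof
    fix b assume b: "b \<in> Basis"
    show "b \<in> span D"
    proof (cases "deg b \<ge> 1")
      case True
      then show ?thesis using D_index[OF b] inD by blast
    next
      case False
      have "dual b' \<in> span D" if "b' \<in> Basis" "deg b' = 1 - deg b" for b'
      proof -
        have "deg b' \<ge> 1" using False that(2) by simp
        from D_index[OF \<open>b' \<in> Basis\<close> this] obtain i k
          where "i \<in> I" "k \<le> n i" "dual b' = (1 / c i k) \<odot> d i (n i - k)" by blast
        then show ?thesis using inD[of i "n i - k"] by (simp add: span_scale)
      qed
      then have "span (dual ` {b'\<in>Basis. deg b' = 1 - deg b}) \<subseteq> span D"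
        by (intro span_minimal subspace_span) auto
      moreover have "b \<in> part (1 - (1 - deg b))" using Basis_in_part[OF b] by simp
      ultimately show ?thesis using part_in_span_dual by blast
    qed
  qed
  then have "span Basis \<subseteq> span D" by (rule span_minimal) (rule subspace_span)
  then have span: "span {d i k | i k. i \<in> I \<and> k \<le> n i} = UNIV"
    by (auto simp: span_Basis D_def)
  have "string_decomposition scale Basis deg om I n d"
    by unfold_locales (use om_d torus_d span in \<open>auto simp: I_def c_def\<close>)
  then show ?thesis by blast
qed

theorem decreasing_iff_exists_SL2_extension:
  "(\<forall>m\<ge>1. mult (m + 1) \<le> mult m) \<longleftrightarrow>
    (\<exists>rho. algebraic_SL2_hom scale om rho \<and> (\<forall>x. x \<noteq> 0 \<longrightarrow> rho (diag_torus x) = torus x))"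
proof
  assume "\<forall>m\<ge>1. mult (m + 1) \<le> mult m"
  then obtain I n and d :: "nat \<Rightarrow> nat \<Rightarrow> 'g" where "string_decomposition scale Basis deg om I n d"
    using exists_string_decomposition by blast
  then interpret string_decomposition scale Basis deg om I n d .
  show "\<exists>rho. algebraic_SL2_hom scale om rho \<and> (\<forall>x. x \<noteq> 0 \<longrightarrow> rho (diag_torus x) = torus x)"
    using sym_action_algebraic sym_action_torus by blast
next
  assume "\<exists>rho. algebraic_SL2_hom scale om rho \<and> (\<forall>x. x \<noteq> 0 \<longrightarrow> rho (diag_torus x) = torus x)"
  then obtain rho where "algebraic_SL2_hom scale om rho" "\<And>x. x \<noteq> 0 \<Longrightarrow> rho (diag_torus x) = torus x"
    by blast
  then interpret sl2_extension scale Basis deg om rho by unfold_locales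
  show "\<forall>m\<ge>1. mult (m + 1) \<le> mult m" using mult_decreasing by blast
qed

end

section \<open>Characters\<close>

lemma sl2_char_odd:
  assumes "m \<ge> 1"
  shows "sl2_char (nat (2 * m - 1)) x = (\<Sum>j\<in>{1 - m..m}. x powi (2 * j - 1))"
  unfolding sl2_char_def
  by (rule sum.reindex_bij_witness[where i = "\<lambda>j. nat (m - j)" and j = "\<lambda>k. m - int k"])
    (use assms in \<open>auto simp: algebra_simps\<close>)

lemma sum_interval_extend:
  fixes g :: "int \<Rightarrow> complex"
  shows "(\<Sum>j\<in>{1 - int (Suc N)..int (Suc N)}. g j)
    = (\<Sum>j\<in>{1 - int N..int N}. g j) + (g (int N + 1) + g (- int N))"
proof -
  have "{1 - int (Suc N)..int (Suc N)} = insert (int N + 1) (insert (- int N) {1 - int N..int N})"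
    by auto
  then show ?thesis by simp
qed

text \<open>
  Summation by parts, in a form that keeps the boundary term and so admits induction on \<open>N\<close>.
\<close>
lemma symmetric_character_Abel:
  assumes sym: "\<And>j. h (1 - j) = h j"
  shows "(\<Sum>j\<in>{1 - int N..int N}. of_nat (h j) * x powi (2 * j - 1))
    = (\<Sum>m\<in>{1..int N}. of_int (sl2_coeff h m) * sl2_char (nat (2 * m - 1)) x)
      + of_nat (h (int N + 1)) * (\<Sum>j\<in>{1 - int N..int N}. x powi (2 * j - 1))"
proof (induction N)
  case 0
  show ?case by simp
next
  case (Suc N)
  define X where "X k = (\<Sum>j\<in>{1 - int k..int k}. x powi (2 * j - 1))" for k
  define S where "S k = (\<Sum>m\<in>{1..int k}. of_int (sl2_coeff h m) * sl2_char (nat (2 * m - 1)) x)" for k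
  have S: "S (Suc N) = S N + of_int (sl2_coeff h (int N + 1)) * X (Suc N)"
  proof -
    have "{1..int (Suc N)} = insert (int N + 1) {1..int N}" by auto
    moreover have "sl2_char (nat (2 * (int N + 1) - 1)) x = X (Suc N)"
      unfolding X_def by (subst sl2_char_odd) (auto simp: algebra_simps)
    ultimately show ?thesis by (simp add: S_def)
  qed
  have X: "X (Suc N) = X N + (x powi (2 * (int N + 1) - 1) + x powi (2 * (- int N) - 1))"
    unfolding X_def by (rule sum_interval_extend)
  have hN: "h (- int N) = h (int N + 1)" using sym[of "int N + 1"] by simp
  have "(\<Sum>j\<in>{1 - int (Suc N)..int (Suc N)}. of_nat (h j) * x powi (2 * j - 1))
      = S N + of_nat (h (int N + 1)) * X N
        + of_nat (h (int N + 1)) * (x powi (2 * (int N + 1) - 1) + x powi (2 * (- int N) - 1))"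
    unfolding sum_interval_extend Suc.IH by (simp add: X_def S_def hN distrib_left)
  also have "\<dots> = S N + of_nat (h (int N + 1)) * X (Suc N)"
    by (simp only: X distrib_left add.assoc)
  also have "\<dots> = S (Suc N) + of_nat (h (int (Suc N) + 1)) * X (Suc N)"
    unfolding S by (simp add: sl2_coeff_def algebra_simps)
  finally show ?case by (simp only: S_def X_def)
qed

lemma centered_character_decomposition:
  assumes fin: "finite {j. h j \<noteq> 0}" and sym: "\<And>j. h (1 - j) = h j"
  shows "centered_character h x = (\<Sum>m | m \<ge> 1 \<and> sl2_coeff h m \<noteq> 0.
    of_int (sl2_coeff h m) * sl2_char (nat (2 * m - 1)) x)"
proof -
  obtain N where N: "\<And>j. h j \<noteq> 0 \<Longrightarrow> j \<le> int N"
  proof -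
    obtain M where M: "\<And>j. h j \<noteq> 0 \<Longrightarrow> j \<le> M"
      using bdd_above_finite[OF fin] by (auto simp: bdd_above_def)
    have "j \<le> int (nat M)" if "h j \<noteq> 0" for j using M[OF that] by simp
    then show thesis by (rule that)
  qed
  have supp: "{j. h j \<noteq> 0} \<subseteq> {1 - int N..int N}"
  proof
    fix j assume "j \<in> {j. h j \<noteq> 0}"
    then show "j \<in> {1 - int N..int N}" using N[of j] N[of "1 - j"] sym[of j] by auto
  qed
  have top: "h (int N + 1) = 0" using N[of "int N + 1"] by auto
  have coeff: "sl2_coeff h m = 0" if "m > int N" for m
    using N[of m] N[of "m + 1"] that by (force simp: sl2_coeff_def)
  have "centered_character h x = (\<Sum>j\<in>{1 - int N..int N}. of_nat (h j) * x powi (2 * j - 1))"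
    unfolding centered_character_def by (rule sum.mono_neutral_left) (use supp in auto)
  also have "\<dots> = (\<Sum>m\<in>{1..int N}. of_int (sl2_coeff h m) * sl2_char (nat (2 * m - 1)) x)"
    by (simp add: symmetric_character_Abel[of h, OF sym] top)
  also have "\<dots> = (\<Sum>m | m \<ge> 1 \<and> sl2_coeff h m \<noteq> 0.
      of_int (sl2_coeff h m) * sl2_char (nat (2 * m - 1)) x)"
    by (rule sum.mono_neutral_right) (use coeff in \<open>force+\<close>)
  finally show ?thesis .
qed

text \<open>
  At \<open>m = N\<close> the coefficient is \<open>h N\<close> itself.
\<close>
lemma strictly_unimodal_iff:
  assumes "largest_support h N"
  shows "strictly_unimodal h N \<longleftrightarrow> (\<forall>m. 1 \<le> m \<and> m \<le> N \<longrightarrow> sl2_coeff h m > 0)"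
proof -
  have N: "h N > 0" "h (N + 1) = 0" using assms by (auto simp: largest_support_def)
  show ?thesis
    unfolding strictly_unimodal_def sl2_coeff_def
    using N by (auto simp: le_less)
qed

section \<open>Frobenius Lie algebras\<close>

lemma kirillov_symplectic_space:
  assumes "complex_lie_algebra smul br" "frobenius_functional smul br F" "complex_space smul E"
  shows "symplectic_space smul E (kirillov_form br F)"
proof -
  interpret complex_lie_algebra smul br by fact
  interpret E: complex_space smul E by fact
  have F: "Vector_Spaces.linear smul (*) F"
    and nd: "\<And>x. (\<And>y. kirillov_form br F x y = 0) \<Longrightarrow> x = 0"
    using assms(2) by (auto simp: frobenius_functional_def)
  interpret F: Vector_Spaces.linear smul "(*)" F by (rule F)
  show ?thesis
  proof (intro symplectic_space.intro symplectic_space_axioms.intro)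
    fix x y
    show "Vector_Spaces.linear smul (*) (\<lambda>x. kirillov_form br F x y)"
      using Vector_Spaces.linear_compose[OF br_linear_left F]
      by (simp add: kirillov_form_def comp_def)
    show "Vector_Spaces.linear smul (*) (kirillov_form br F x)"
      using Vector_Spaces.linear_compose[OF br_linear_right F]
      by (simp add: kirillov_form_def[abs_def] comp_def)
    show "kirillov_form br F x x = 0"
      by (simp add: kirillov_form_def br_alternating)
    show "x = 0" if "\<And>y. kirillov_form br F x y = 0"
      using that by (rule nd)
  qed fact
qed

context complex_lie_algebra
begin

lemma exists_finite_basis: "\<exists>B. complex_space smul B"
proof -
  obtain S where S: "finite S" "span S = UNIV" using finite_dim by blast
  obtain B where B: "B \<subseteq> S" "independent B" "S \<subseteq> span B"
    using maximal_independent_subset[of S] by blast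
  have "span B = UNIV" using span_mono[OF B(3)] S(2) by (simp add: span_span top.extremum_unique)
  then have "complex_space smul B"
    by unfold_locales (use B S finite_subset in auto)
  then show ?thesis by blast
qed

lemma br_add_scale [simp]:
  "br (x + x') y = br x y + br x' y" "br (smul c x) y = smul c (br x y)"
  "br x (y + y') = br x y + br x y'" "br x (smul c y) = smul c (br x y)"
  using br_linear_left[of y] br_linear_right[of x] by (auto simp: Vector_Spaces.linear_iff)

lemma br_swap: "br y x = - br x y"
proof -
  have "0 = br (x + y) (x + y)" by (simp only: br_alternating)
  also have "\<dots> = br x x + br x y + (br y x + br y y)" by (simp only: br_add_scale add_ac)
  also have "\<dots> = br x y + br y x" by (simp only: br_alternating) simp
  finally show ?thesis by (metis add_eq_0_iff)
qed

text \<open>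
  This form of the Jacobi identity makes the bracket of two eigenvectors of \<open>ad z\<close> an eigenvector
  for the sum of their eigenvalues.
\<close>
lemma br_derivation: "br z (br x y) = br (br z x) y + br x (br z y)"
proof -
  have "br x (br y z) = - br x (br z y)"
    using br_swap[of y z] br_add_scale(4)[of x "-1" "br z y"] by simp
  moreover have "br y (br z x) = - br (br z x) y" by (rule br_swap)
  ultimately show ?thesis using jacobi[of z x y] by (simp add: algebra_simps)
qed

text \<open>
  The functional itself is represented by a unique vector with respect to the Kirillov form, so the
  definite description in \<open>principal_element\<close> is meaningful.
\<close>
lemma principal_element_eq:
  assumes fr: "frobenius_functional smul br F"
  shows "F (br (principal_element br F) x) = F x"
proof -
  obtain B where "complex_space smul B" using exists_finite_basis by blast
  then interpret symplectic_space smul B "kirillov_form br F"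
    using kirillov_symplectic_space[OF complex_lie_algebra_axioms fr] by blast
  have F: "Vector_Spaces.linear smul (*) F" using fr by (simp add: frobenius_functional_def)
  interpret F: Vector_Spaces.linear smul "(*)" F by (rule F)
  obtain y where y: "\<And>x. kirillov_form br F x y = F x" using representing_vector[OF F] by blast
  have H: "F (br (- y) x) = F x" for x
    using y[of x] om_swap[of x y] br_add_scale(2)[of "-1" y x] F.neg
    by (simp add: kirillov_form_def)
  have "\<exists>!H. \<forall>x. F (br H x) = F x"
  proof (rule ex1I[of _ "- y"])
    show "\<forall>x. F (br (- y) x) = F x" using H by blast
    fix H assume H': "\<forall>x. F (br H x) = F x"
    show "H = - y"
    proof (rule om_eqI)
      fix b
      show "kirillov_form br F b H = kirillov_form br F b (- y)"
        using H' H[of b] om_swap[of b H] om_swap[of b "- y"] by (simp add: kirillov_form_def)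
    qed
  qed
  from theI'[OF this] show ?thesis unfolding principal_element_def by blast
qed

text \<open>
  Applying \<open>F \<circ> ad H = F\<close> to the bracket, an eigenvector of eigenvalue \<open>a + b\<close>, multiplies the value
  of the form by \<open>a + b\<close>.
\<close>
lemma kirillov_form_eigenvectors:
  assumes fr: "frobenius_functional smul br F"
    and x: "br (principal_element br F) x = smul a x"
    and y: "br (principal_element br F) y = smul b y"
    and ab: "a + b \<noteq> 1"
  shows "kirillov_form br F x y = 0"
proof -
  interpret F: Vector_Spaces.linear smul "(*)" F
    using fr by (simp add: frobenius_functional_def)
  have "F (br x y) = F (br (principal_element br F) (br x y))"
    by (simp add: principal_element_eq[OF fr])
  also have "\<dots> = (a + b) * F (br x y)"
    by (simp add: br_derivation x y F.add F.scale distrib_right)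
  finally show ?thesis using ab by (simp add: kirillov_form_def)
qed

lemma principal_grading:
  assumes fr: "frobenius_functional smul br F"
    and ss: "semisimple_endomorphism smul (br (principal_element br F))"
    and int: "integral_eigenvalues smul (br (principal_element br F))"
  shows "\<exists>E deg. graded_symplectic smul E deg (kirillov_form br F) \<and>
    (\<forall>j. principal_part smul br F j = graded_space.part smul E deg j)"
proof -
  let ?T = "br (principal_element br F)"
  obtain B where "complex_space smul B" using exists_finite_basis by blast
  then interpret B: complex_space smul B .
  obtain E deg where E: "complex_space smul E" "\<And>b. b \<in> E \<Longrightarrow> ?T b = smul (of_int (deg b)) b"
    using B.semisimple_integral_eigenbasis[OF ss int] by blast
  interpret symplectic_space smul E "kirillov_form br F"
    by (rule kirillov_symplectic_space[OF complex_lie_algebra_axioms fr E(1)])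
  have "graded_symplectic smul E deg (kirillov_form br F)"
  proof unfold_locales
    fix b c assume bc: "b \<in> E" "c \<in> E" "deg b + deg c \<noteq> 1"
    then have "of_int (deg b) + of_int (deg c) \<noteq> (1 :: complex)"
      by (metis of_int_1 of_int_add of_int_eq_iff)
    then show "kirillov_form br F b c = 0"
      using kirillov_form_eigenvectors[OF fr E(2) E(2)] bc by blast
  qed
  moreover from this interpret graded_symplectic smul E deg "kirillov_form br F" .
  have "principal_part smul br F j = part j" for j
    unfolding principal_part_def by (rule eigenspace_eq_part[OF br_linear_right E(2)])
  ultimately show ?thesis by blast
qed

end

theorem theoremC:
  fixes smul :: "complex \<Rightarrow> 'g::ab_group_add \<Rightarrow> 'g"
    and br :: "'g \<Rightarrow> 'g \<Rightarrow> 'g"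
    and F :: "'g \<Rightarrow> complex"
    and h :: "int \<Rightarrow> nat"
    and lam :: "complex \<Rightarrow> 'g \<Rightarrow> 'g"
  assumes "complex_lie_algebra smul br"
    and "frobenius_functional smul br F"
    and "semisimple_endomorphism smul (br (principal_element br F))"
    and "integral_eigenvalues smul (br (principal_element br F))"
    and h: "h = principal_mult smul br F"
    and lam: "lam = centered_cocharacter smul br F"
  shows
    "lam \<in> hom mult_group (symplectic_group smul (kirillov_form br F)) \<and>
     (\<forall>x j v. x \<noteq> 0 \<and> v \<in> principal_part smul br F j \<longrightarrow>
        lam x v = smul (x powi (2 * j - 1)) v) \<and>
     finite {j. h j \<noteq> 0} \<and>
     (\<forall>x. x \<noteq> 0 \<longrightarrow> centered_character h x =
        (\<Sum>m | m \<ge> 1 \<and> sl2_coeff h m \<noteq> 0. of_int (sl2_coeff h m) * sl2_char (nat (2 * m - 1)) x)) \<and>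
     (unimodal h \<longleftrightarrow> (\<forall>m\<ge>1. sl2_coeff h m \<ge> 0)) \<and>
     ((\<forall>m\<ge>1. sl2_coeff h m \<ge> 0) \<longleftrightarrow>
        (\<exists>\<rho>. algebraic_SL2_hom smul (kirillov_form br F) \<rho> \<and>
             (\<forall>x. x \<noteq> 0 \<longrightarrow> \<rho> (diag_torus x) = lam x))) \<and>
     (\<forall>N. largest_support h N \<longrightarrow>
        (strictly_unimodal h N \<longleftrightarrow> (\<forall>m. 1 \<le> m \<and> m \<le> N \<longrightarrow> sl2_coeff h m > 0)))"
proof -
  interpret complex_lie_algebra smul br by fact
  obtain E deg where gs: "graded_symplectic smul E deg (kirillov_form br F)"
    and part: "\<And>j. principal_part smul br F j = graded_space.part smul E deg j"
    using principal_grading assms(2-4) by blast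
  interpret G: graded_symplectic smul E deg "kirillov_form br F" by (rule gs)
  have h_mult: "h = G.mult"
    by (rule ext) (simp add: h principal_mult_def part G.dim_part)
  have lam_torus: "lam x = G.torus x" for x
    unfolding lam centered_cocharacter_def part
    by (rule the_equality) (use G.linear_torus G.torus_part G.torus_unique in blast)+
  have fin: "finite {j. h j \<noteq> 0}" unfolding h_mult by (rule G.finite_mult_support)
  have coeff: "(\<forall>m\<ge>1. sl2_coeff h m \<ge> 0) \<longleftrightarrow> (\<forall>m\<ge>1. h (m + 1) \<le> h m)"
    by (simp add: sl2_coeff_def)
  show ?thesis
  proof (intro conjI allI impI)
    show "lam \<in> hom mult_group (symplectic_group smul (kirillov_form br F))"
      by (rule G.torus_hom) (rule lam_torus)
    show "lam x v = smul (x powi (2 * j - 1)) v" if "x \<noteq> 0 \<and> v \<in> principal_part smul br F j" for x j v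
      using that G.torus_part by (simp add: lam_torus part)
    show "finite {j. h j \<noteq> 0}" by (rule fin)
    show "centered_character h x = (\<Sum>m | m \<ge> 1 \<and> sl2_coeff h m \<noteq> 0.
        of_int (sl2_coeff h m) * sl2_char (nat (2 * m - 1)) x)" for x
      by (rule centered_character_decomposition[OF fin]) (simp add: h_mult G.mult_symmetric)
    show "unimodal h \<longleftrightarrow> (\<forall>m\<ge>1. sl2_coeff h m \<ge> 0)"
      unfolding coeff by (simp add: unimodal_def)
    show "(\<forall>m\<ge>1. sl2_coeff h m \<ge> 0) \<longleftrightarrow>
        (\<exists>\<rho>. algebraic_SL2_hom smul (kirillov_form br F) \<rho> \<and>
             (\<forall>x. x \<noteq> 0 \<longrightarrow> \<rho> (diag_torus x) = lam x))"
      unfolding coeff unfolding h_mult lam_torus by (rule G.decreasing_iff_exists_SL2_extension)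
    show "strictly_unimodal h N \<longleftrightarrow> (\<forall>m. 1 \<le> m \<and> m \<le> N \<longrightarrow> sl2_coeff h m > 0)"
      if "largest_support h N" for N
      by (rule strictly_unimodal_iff[OF that])
  qed
qed

end
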